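(* Let $D\in(0,\infty]$ and let $a,b$ be Borel measurable on $[0,D]$ with $a>0$ on $(0,D)$ and with $b/a$ and $e^{C}/a$ locally integrable on $[0,D]$, where $C(x)=\int_0^x \frac{b(u)}{a(u)}\,du$. Let $\lambda_0$ be the mixed (Dirichlet at $0$, Neumann at $D$) eigenvalue and $II$ the double integral operator defined in the context. Assume that $\mu(0,D)<\infty$ and $\delta:=\sup_{x\in(0,D)}\nu(0,x)\,\mu(x,D)<\infty$. Set $\varphi(x)=\nu(0,x)$ for $x\in(0,D)$. (1) Define $f_1=\sqrt\varphi$, $f_n=f_{n-1}\,II(f_{n-1})$ for $n\ge2$, and let $\delta_n=\sup_{x\in(0,D)}II(f_n)(x)$, $n\ge1$. Then $\delta_n$ is decreasing in $n$ and $$\lambda_0\ge\delta_n^{-1}\ge(4\delta)^{-1},\qquad n\ge1.$$ (2) For fixed $x_0\in(0,D)$, define $$f_1^{(x_0)}=\varphi(\cdot\wedge x_0),\qquad f_n^{(x_0)}=\big(f_{n-1}^{(x_0)}\,II(f_{n-1}^{(x_0)})\big)(\cdot\wedge x_0),\quad n\ge2,$$ and let $\delta_n'=\sup_{x_0\in(0,D)}\inf_{x\in(0,D)}II(f_n^{(x_0)})(x)$. Then $\delta_n'$ is increasing in $n$ and $$\delta^{-1}\ge{\delta_n'}^{-1}\ge\lambda_0,\qquad n\ge1.$$ Next, define $$\bar\delta_n=\sup_{x_0\in(0,D)}\frac{\mu\big((f_n^{(x_0)})^2\big)}{D(f_n^{(x_0)})},\qquad n\ge1.$$ Then $\bar\delta_n^{-1}\ge\lambda_0$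 and $\bar\delta_{n+1}\ge\delta_n'$ for every $n\ge1$, and $\bar\delta_1=\delta_1'$.
   Context: When $D=\infty$, $[0,D]$ is read as $[0,\infty)$ and $\mathcal C[0,D]$ as $\mathcal C[0,\infty)$. $\mu(dx)=\frac{e^{C(x)}}{a(x)}dx$, $\nu(dx)=e^{-C(x)}dx$, $\mu(\alpha,\beta)=\int_\alpha^\beta d\mu$, $\nu(\alpha,\beta)=\int_\alpha^\beta d\nu$, $\mu(f)=\int_0^D f\,d\mu$, $D(f)=\int_0^D a\,f'^2\,d\mu$ ($f'$ a.e. for functions of the form $f(\cdot\wedge x_0)$; the functional $D(\cdot)$ is distinct from the endpoint $D$). $$\lambda_0=\inf\Big\{\frac{D(f)}{\mu(f^2)}: f\in\mathcal C^1(0,D)\cap\mathcal C[0,D],\ D(f)<\infty,\ f(0)=0,\ f\ne0\Big\},$$ $$II(f)(x)=\frac1{f(x)}\int_0^x\nu(ds)\int_s^D f\,d\mu .$$ *)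

theory Defs
  imports "HOL-Analysis.Analysis"
begin

text \<open>
  The right endpoint \<open>D\<close> is an extended real. The open interval is the library's \<open>einterval 0 D\<close>;
  the closed one is the following, which is \<open>[0,\<infinity>)\<close> if \<open>D = \<infinity>\<close>.
\<close>

definition cinterval :: "ereal \<Rightarrow> real set" where
  "cinterval D = {x. 0 \<le> x \<and> ereal x \<le> D}"

definition locally_integrable_on :: "(real \<Rightarrow> real) \<Rightarrow> real set \<Rightarrow> bool" where
  "locally_integrable_on f S \<longleftrightarrow> (\<forall>K. compact K \<and> K \<subseteq> S \<longrightarrow> set_integrable lborel K f)"

definition C_fun :: "(real \<Rightarrow> real) \<Rightarrow> (real \<Rightarrow> real) \<Rightarrow> real \<Rightarrow> real" where
  "C_fun a b x = (LBINT u:{0..x}. b u / a u)"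

text \<open>Both measures live on the real line and are concentrated on \<open>(0,D)\<close>.\<close>

definition mu :: "(real \<Rightarrow> real) \<Rightarrow> (real \<Rightarrow> real) \<Rightarrow> ereal \<Rightarrow> real measure" where
  "mu a b D = density lborel
     (\<lambda>x. ennreal (exp (C_fun a b x) / a x) * indicator (einterval 0 D) x)"

definition nu :: "(real \<Rightarrow> real) \<Rightarrow> (real \<Rightarrow> real) \<Rightarrow> ereal \<Rightarrow> real measure" where
  "nu a b D = density lborel
     (\<lambda>x. ennreal (exp (- C_fun a b x)) * indicator (einterval 0 D) x)"

definition mu_sq :: "(real \<Rightarrow> real) \<Rightarrow> (real \<Rightarrow> real) \<Rightarrow> ereal \<Rightarrow> (real \<Rightarrow> real) \<Rightarrow> ennreal" where
  "mu_sq a b D f = (\<integral>\<^sup>+x\<in>einterval 0 D. ennreal ((f x)\<^sup>2) \<partial>mu a b D)"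

text \<open>
  The value of \<open>deriv f\<close> at a point where \<open>f\<close> is not differentiable is unspecified; for the
  functions stopped at \<open>x\<^sub>0\<close> used below this concerns at most the null set \<open>{x\<^sub>0}\<close> in \<open>(0,D)\<close>.
\<close>

definition energy :: "(real \<Rightarrow> real) \<Rightarrow> (real \<Rightarrow> real) \<Rightarrow> ereal \<Rightarrow> (real \<Rightarrow> real) \<Rightarrow> ennreal" where
  "energy a b D f = (\<integral>\<^sup>+x\<in>einterval 0 D. ennreal (a x * (deriv f x)\<^sup>2) \<partial>mu a b D)"

definition lambda0 :: "(real \<Rightarrow> real) \<Rightarrow> (real \<Rightarrow> real) \<Rightarrow> ereal \<Rightarrow> ennreal" where
  "lambda0 a b D = Inf {energy a b D f / mu_sq a b D f | f.
     f C1_differentiable_on einterval 0 D \<and> continuous_on (cinterval D) f \<and>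
     energy a b D f < \<infinity> \<and> f 0 = 0 \<and> (\<exists>x\<in>cinterval D. f x \<noteq> 0)}"

definition II :: "(real \<Rightarrow> real) \<Rightarrow> (real \<Rightarrow> real) \<Rightarrow> ereal \<Rightarrow> (real \<Rightarrow> ennreal) \<Rightarrow> real \<Rightarrow> ennreal" where
  "II a b D f x =
     (\<integral>\<^sup>+s\<in>{0<..<x}. (\<integral>\<^sup>+u\<in>einterval (ereal s) D. f u \<partial>mu a b D) \<partial>nu a b D) / f x"

definition delta :: "(real \<Rightarrow> real) \<Rightarrow> (real \<Rightarrow> real) \<Rightarrow> ereal \<Rightarrow> ennreal" where
  "delta a b D = (SUP x\<in>einterval 0 D.
     emeasure (nu a b D) {0<..<x} * emeasure (mu a b D) (einterval (ereal x) D))"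

definition phi :: "(real \<Rightarrow> real) \<Rightarrow> (real \<Rightarrow> real) \<Rightarrow> ereal \<Rightarrow> real \<Rightarrow> ennreal" where
  "phi a b D x = emeasure (nu a b D) {0<..<x}"

text \<open>
  In both iterations the index starts at \<open>n = 1\<close>; the value at \<open>n = 0\<close> is irrelevant. The functions
  take values in \<open>[0,\<infinity>]\<close>, so that no integral is silently replaced by \<open>0\<close>; \<open>enn2real\<close> is applied
  only to \<open>phi\<close> on \<open>(0,D)\<close> and to the stopped functions, which are finite there whenever \<open>b / a\<close> is
  locally integrable and \<open>\<mu>(0,D) < \<infinity>\<close>.
\<close>

definition f_seq :: "(real \<Rightarrow> real) \<Rightarrow> (real \<Rightarrow> real) \<Rightarrow> ereal \<Rightarrow> nat \<Rightarrow> real \<Rightarrow> ennreal" where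
  "f_seq a b D n = ((\<lambda>f x. f x * II a b D f x) ^^ (n - 1))
     (\<lambda>x. ennreal (sqrt (enn2real (phi a b D x))))"

definition delta_seq :: "(real \<Rightarrow> real) \<Rightarrow> (real \<Rightarrow> real) \<Rightarrow> ereal \<Rightarrow> nat \<Rightarrow> ennreal" where
  "delta_seq a b D n = (SUP x\<in>einterval 0 D. II a b D (f_seq a b D n) x)"

definition f_stop :: "(real \<Rightarrow> real) \<Rightarrow> (real \<Rightarrow> real) \<Rightarrow> ereal \<Rightarrow> real \<Rightarrow> nat \<Rightarrow> real \<Rightarrow> ennreal" where
  "f_stop a b D x0 n =
     ((\<lambda>f x. f (min x x0) * II a b D f (min x x0)) ^^ (n - 1)) (\<lambda>x. phi a b D (min x x0))"

definition delta'_seq :: "(real \<Rightarrow> real) \<Rightarrow> (real \<Rightarrow> real) \<Rightarrow> ereal \<Rightarrow> nat \<Rightarrow> ennreal" where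
  "delta'_seq a b D n =
     (SUP x0\<in>einterval 0 D. INF x\<in>einterval 0 D. II a b D (f_stop a b D x0 n) x)"

definition delta_bar :: "(real \<Rightarrow> real) \<Rightarrow> (real \<Rightarrow> real) \<Rightarrow> ereal \<Rightarrow> nat \<Rightarrow> ennreal" where
  "delta_bar a b D n = (SUP x0\<in>einterval 0 D.
     mu_sq a b D (\<lambda>x. enn2real (f_stop a b D x0 n x)) /
     energy a b D (\<lambda>x. enn2real (f_stop a b D x0 n x)))"

end

theory Submission
  imports Defs
begin

text \<open>
  Write \<open>\<phi>(x) = \<nu>(0,x)\<close>, and for a nonnegative function \<open>f\<close> let \<open>T f(s) = \<integral>\<^sub>s\<^sup>D f d\<mu>\<close> (\<open>tail\<close>)
  and \<open>P h(x) = \<integral>\<^sub>0\<^sup>x h d\<nu>\<close> (\<open>prim\<close>), so that \<open>f II(f) = P(T f)\<close>. Two facts carry everything.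
  Tonelli's theorem makes \<open>P\<close> and \<open>T\<close> adjoint, \<open>\<integral> h T f d\<nu> = \<integral> f P h d\<mu>\<close>
  (\<open>nn_integral_mult_tail\<close>). And if \<open>f = P r\<close>, then \<open>f' = r e\<^sup>-\<^sup>C\<close>, so that \<open>D(f) = \<integral> r\<^sup>2 d\<nu>\<close>
  (\<open>energy_eq\<close>).

  Lower bounds for \<open>\<lambda>\<^sub>0\<close>. Suppose \<open>P(T g) \<le> K g\<close> for some positive finite \<open>g\<close>. Cauchy--Schwarz with the
  weight \<open>T g\<close> gives \<open>(P r)\<^sup>2 \<le> P(r\<^sup>2 / T g) P(T g) \<le> K g P(r\<^sup>2 / T g)\<close>. Integrating in \<open>\<mu>\<close> and moving
  \<open>P\<close> to the other side as \<open>T\<close> cancels the weight and leaves \<open>\<mu>((P r)\<^sup>2) \<le> K \<integral> r\<^sup>2 d\<nu>\<close>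
  (\<open>Hardy_if_prim_tail_le\<close>), hence \<open>\<lambda>\<^sub>0 \<ge> 1 / K\<close> (\<open>inverse_le_lambda0\<close>). The function \<open>g = f\<^sub>n\<close> satisfies
  the hypothesis with \<open>K = \<delta>\<^sub>n\<close>. Since \<open>P\<close> and \<open>T\<close> are monotone and \<open>f\<^sub>n\<^sub>+\<^sub>1 = P(T f\<^sub>n) \<le> \<delta>\<^sub>n f\<^sub>n\<close>, the
  constant of \<open>f\<^sub>n\<^sub>+\<^sub>1\<close> is at most \<open>\<delta>\<^sub>n\<close>. Finally \<open>\<delta>\<^sub>1 \<le> 4\<delta>\<close> (\<open>prim_tail_sqrt_Phi_le\<close>), because \<open>\<mu>(t,D) \<le> \<delta>/\<phi>(t)\<close>
  turns \<open>T(\<surd>\<phi>)\<close> into the integral of an exact derivative, \<open>T(\<surd>\<phi>) \<le> 2\<delta>/\<surd>\<phi>\<close>, and \<open>P(1/\<surd>\<phi>) = 2\<surd>\<phi>\<close>.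

  Upper bounds for \<open>\<lambda>\<^sub>0\<close>. The functions \<open>f\<^sub>n\<close> stopped at \<open>x\<^sub>0\<close> have a kink at \<open>x\<^sub>0\<close> and are therefore not
  admissible in the definition of \<open>\<lambda>\<^sub>0\<close>. Letting the derivative decay to zero continuously on a short
  interval to the right of \<open>x\<^sub>0\<close> gives an admissible function that is larger and whose energy is
  larger by an arbitrarily small amount, so \<open>\<lambda>\<^sub>0 \<mu>(f\<^sup>2) \<le> D(f)\<close> also holds for the stopped functions
  (\<open>lambda0_mult_mu_sq_stopped_le\<close>). If \<open>c\<close> is the infimum of \<open>II(f\<^sub>n)\<close>, then \<open>f\<^sub>n\<^sub>+\<^sub>1 \<ge> c f\<^sub>n\<close>. Together with monotonicity
  this shows that the infimum grows with \<open>n\<close>, and together with \<open>D(f\<^sub>n\<^sub>+\<^sub>1) = \<mu>(f\<^sub>n f\<^sub>n\<^sub>+\<^sub>1)\<close>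
  (\<open>energy_f_stop_Suc\<close>) that \<open>\<mu>(f\<^sub>n\<^sub>+\<^sub>1\<^sup>2) \<ge> c D(f\<^sub>n\<^sub>+\<^sub>1)\<close>. For \<open>n = 1\<close> the quotient \<open>II(f\<^sub>1)\<close> is on \<open>(0,x\<^sub>0]\<close>
  the \<open>\<nu>\<close>-average over \<open>(0,x)\<close> of the decreasing function \<open>T f\<^sub>1\<close>. So its infimum is its value at \<open>x\<^sub>0\<close>, and
  by the adjointness this value is \<open>\<mu>(f\<^sub>1\<^sup>2) / D(f\<^sub>1)\<close>.
\<close>

section \<open>Extended nonnegative reals and one-dimensional integrals\<close>

lemma ennreal_inverse_antimono: "x \<le> y \<Longrightarrow> inverse y \<le> inverse (x::ennreal)"
  by (cases "x = 0 \<or> y = top"; cases x; cases y)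
     (auto simp: inverse_ennreal top_unique ennreal_le_iff less_le)

text \<open>
  The conventions \<open>0 / 0 = 0\<close> and \<open>x / \<infinity> = 0\<close> make this hold without exceptions, whereas the reverse
  estimate in the next lemma has to exclude a vanishing or infinite \<open>E\<close>.
\<close>

lemma ennreal_divide_le_inverseI:
  fixes L m E :: ennreal
  assumes "L * m \<le> E"
  shows "m / E \<le> inverse L"
proof (cases "E = 0 \<or> E = top \<or> L = 0 \<or> L = top")
  case True
  then show ?thesis
    using assms by (auto simp: ennreal_top_mult top_unique split: if_splits)
next
  case False
  then show ?thesis
    using assms
    by (cases L; cases m; cases E)
       (auto simp: ennreal_mult[symmetric] divide_ennreal inverse_ennreal ennreal_mult_top top_unique
          field_simps less_le split: if_splits)
qed

lemma ennreal_inverse_le_divideI: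
  fixes K m E :: ennreal
  assumes "m \<le> K * E" "0 < E" "E < top"
  shows "inverse K \<le> E / m"
proof (cases "m = 0 \<or> m = top \<or> K = 0 \<or> K = top")
  case True
  then show ?thesis
    using assms by (auto simp: ennreal_mult_eq_top_iff top_unique split: if_splits)
next
  case False
  then show ?thesis
    using assms
    by (cases K; cases m; cases E)
       (auto simp: ennreal_mult[symmetric] divide_ennreal inverse_ennreal ennreal_mult_top top_unique
          field_simps less_le split: if_splits)
qed

lemma ennreal_le_divideI:
  fixes c m E :: ennreal
  assumes "c * E \<le> m" "0 < E" "E < top"
  shows "c \<le> m / E"
  using divide_right_mono_ennreal[OF assms(1), of E] assms
  by (simp add: ennreal_mult_divide_eq)

lemma ennreal_divide_mult_le: "x / y * y \<le> (x::ennreal)"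
  by (cases "y = 0 \<or> y = top")
     (auto simp: ennreal_divide_times less_top)

lemma ennreal_mult_divide_cancel:
  fixes x y :: ennreal
  assumes "0 < x" "x < top"
  shows "x * (y / x) = y"
  using assms by (simp add: ennreal_times_divide mult.commute[of x] ennreal_mult_divide_eq)

text \<open>
  Monotone convergence along compact subintervals. It turns the fundamental theorem of calculus on
  compact intervals into estimates up to an infinite endpoint or up to a singularity.
\<close>

lemma nn_integral_einterval_le_if_Icc:
  fixes \<alpha> \<beta> :: ereal and h :: "real \<Rightarrow> ennreal"
  assumes [measurable]: "h \<in> borel_measurable borel"
    and le: "\<And>x y. \<alpha> < ereal x \<Longrightarrow> x < y \<Longrightarrow> ereal y < \<beta> \<Longrightarrow> (\<integral>\<^sup>+t\<in>{x..y}. h t \<partial>lborel) \<le> c"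
  shows "(\<integral>\<^sup>+t\<in>einterval \<alpha> \<beta>. h t \<partial>lborel) \<le> c"
proof (cases "\<alpha> < \<beta>")
  case True
  obtain u l where ul: "einterval \<alpha> \<beta> = (\<Union>i. {l i .. u i})" "incseq u" "decseq l"
    "\<And>i. l i < u i" "\<And>i. \<alpha> < ereal (l i)" "\<And>i. ereal (u i) < \<beta>"
    by (rule einterval_Icc_approximation[OF True]) blast
  have inc: "incseq (\<lambda>i. {l i .. u i})"
    using ul(2,3) by (auto simp: incseq_def decseq_def intro: order_trans)
  have "(\<integral>\<^sup>+t\<in>einterval \<alpha> \<beta>. h t \<partial>lborel) = emeasure (density lborel h) (\<Union>i. {l i .. u i})"
    using ul(1) by (simp add: emeasure_density)
  also have "\<dots> = (SUP i. emeasure (density lborel h) {l i .. u i})"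
    using inc by (intro SUP_emeasure_incseq[symmetric]) auto
  also have "\<dots> \<le> c"
    using ul le by (intro SUP_least) (simp add: emeasure_density)
  finally show ?thesis .
next
  case False
  then have "einterval \<alpha> \<beta> = {}"
    by (auto simp: einterval_def)
  then show ?thesis by simp
qed

lemma nn_integral_einterval_pos:
  fixes \<alpha> \<beta> :: ereal and h :: "real \<Rightarrow> ennreal"
  assumes [measurable]: "h \<in> borel_measurable borel"
    and "\<alpha> < \<beta>" and pos: "\<And>x. x \<in> einterval \<alpha> \<beta> \<Longrightarrow> 0 < h x"
  shows "0 < (\<integral>\<^sup>+t\<in>einterval \<alpha> \<beta>. h t \<partial>lborel)"
proof (rule ccontr)
  assume "\<not> ?thesis"
  then have "(\<integral>\<^sup>+t. h t * indicator (einterval \<alpha> \<beta>) t \<partial>lborel) = 0"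
    by simp
  then have "AE t in lborel. h t * indicator (einterval \<alpha> \<beta>) t = 0"
    by (subst (asm) nn_integral_0_iff_AE) auto
  then have "AE t in lborel. t \<notin> einterval \<alpha> \<beta>"
    by eventually_elim (use pos in \<open>force split: split_indicator_asm\<close>)
  then have "emeasure lborel (einterval \<alpha> \<beta>) = 0"
    by (subst (asm) AE_iff_measurable[where N="einterval \<alpha> \<beta>"]) auto
  moreover obtain u l where "einterval \<alpha> \<beta> = (\<Union>i. {l i .. u i})" "\<And>i::nat. l i < (u i::real)"
    by (rule einterval_Icc_approximation[OF \<open>\<alpha> < \<beta>\<close>]) blast
  then have sub: "{l 0..u 0} \<subseteq> einterval \<alpha> \<beta>" and "l 0 < u 0" by auto
  then have "0 < emeasure lborel {l 0..u 0}"
    by simp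
  moreover have "emeasure lborel {l 0..u 0} \<le> emeasure lborel (einterval \<alpha> \<beta>)"
    using sub by (rule emeasure_mono) simp
  ultimately show False by simp
qed

lemma has_real_derivative_LBINT_from_0:
  fixes q :: "real \<Rightarrow> real"
  assumes "continuous_on UNIV q"
  shows "((\<lambda>x. LBINT t=0..x. q t) has_real_derivative q x) (at x)"
proof -
  let ?a = "min 0 x - 1" and ?b = "max 0 x + 1"
  have "((\<lambda>x. LBINT t=ereal 0..x. q t) has_vector_derivative q x) (at x within {?a..?b})"
    by (intro interval_integral_FTC2) (auto intro: continuous_on_subset[OF assms])
  then have "((\<lambda>x. LBINT t=ereal 0..x. q t) has_vector_derivative q x) (at x within {?a<..<?b})"
    by (rule has_vector_derivative_within_subset) auto
  then have "((\<lambda>x. LBINT t=ereal 0..x. q t) has_vector_derivative q x) (at x)"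
    by (subst (asm) has_vector_derivative_within_open) auto
  then show ?thesis
    by (simp add: has_real_derivative_iff_has_vector_derivative zero_ereal_def)
qed

lemma nn_integral_Ioo_eq_Icc:
  fixes a b :: real
  shows "(\<integral>\<^sup>+t\<in>{a<..<b}. h t \<partial>lborel) = (\<integral>\<^sup>+t\<in>{a..b}. h t \<partial>lborel)"
proof (rule nn_integral_cong_AE)
  have "AE t in lborel. t \<noteq> a" "AE t in lborel. t \<noteq> b"
    by (rule AE_lborel_singleton)+
  then show "AE t in lborel. h t * indicator {a<..<b} t = h t * indicator {a..b} t"
    by eventually_elim (auto split: split_indicator)
qed

lemma nn_integral_eq_LBINT_from_0:
  fixes q :: "real \<Rightarrow> real"
  assumes q: "continuous_on UNIV q" and "\<And>t. 0 \<le> q t" "0 \<le> x"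
  shows "(\<integral>\<^sup>+t\<in>{0<..<x}. ennreal (q t) \<partial>lborel) = ennreal (LBINT t=0..x. q t)"
proof -
  have "(\<integral>\<^sup>+t\<in>{0..x}. ennreal (q t) \<partial>lborel) = ennreal ((LBINT t=0..x. q t) - (LBINT t=0..ereal 0. q t))"
    using assms by (intro nn_integral_FTC_Icc)
      (auto intro!: borel_measurable_continuous_onI has_real_derivative_LBINT_from_0[OF q]
        has_field_derivative_at_within)
  also have "(LBINT t=0..ereal 0. q t) = 0"
    by (simp add: zero_ereal_def[symmetric])
  finally show ?thesis
    by (simp add: nn_integral_Ioo_eq_Icc)
qed

text \<open>
  The derivative is only required in the open interval, because the admissible functions of \<open>\<lambda>\<^sub>0\<close>
  are merely continuous at the endpoints.
\<close>

lemma abs_diff_le_nn_integral_deriv: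
  fixes f q :: "real \<Rightarrow> real"
  assumes "\<alpha> < \<beta>" and f: "continuous_on {\<alpha>..\<beta>} f"
    and d: "\<And>t. t \<in> {\<alpha><..<\<beta>} \<Longrightarrow> (f has_real_derivative q t) (at t)"
    and q: "continuous_on {\<alpha><..<\<beta>} q"
  shows "ennreal \<bar>f \<beta> - f \<alpha>\<bar> \<le> (\<integral>\<^sup>+t\<in>{\<alpha><..<\<beta>}. ennreal \<bar>q t\<bar> \<partial>lborel)" (is "_ \<le> ?I")
proof -
  obtain u l where ul: "einterval \<alpha> \<beta> = (\<Union>i. {l i .. u i})"
    "\<And>i. l i < u i" "\<And>i. ereal \<alpha> < ereal (l i)" "\<And>i. ereal (u i) < ereal \<beta>"
    "(\<lambda>i. ereal (l i)) \<longlonglongrightarrow> ereal \<alpha>" "(\<lambda>i. ereal (u i)) \<longlonglongrightarrow> ereal \<beta>"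
    using einterval_Icc_approximation[of "ereal \<alpha>" "ereal \<beta>" thesis] \<open>\<alpha> < \<beta>\<close> by simp
  have le: "ennreal \<bar>f (u i) - f (l i)\<bar> \<le> ?I" for i
  proof -
    have sub: "{l i..u i} \<subseteq> {\<alpha><..<\<beta>}"
      using ul(3,4)[of i] by auto
    have cont: "continuous_on {l i..u i} q"
      using continuous_on_subset[OF q sub] .
    have deriv: "(f has_vector_derivative q x) (at x within {l i..u i})" if "l i \<le> x" "x \<le> u i" for x
    proof -
      have "x \<in> {\<alpha><..<\<beta>}" using sub that by (simp add: subset_iff)
      then have "(f has_vector_derivative q x) (at x)"
        using d[of x] by (simp only: has_real_derivative_iff_has_vector_derivative)
      then show ?thesis by (rule has_vector_derivative_at_within)
    qed
    have "l i \<le> u i" using ul(2)[of i] by (rule less_imp_le)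
    then have hb: "has_bochner_integral lborel (\<lambda>x. indicator {l i .. u i} x *\<^sub>R q x) (f (u i) - f (l i))"
      using deriv cont by (rule has_bochner_integral_FTC_Icc)
    have "ennreal \<bar>f (u i) - f (l i)\<bar> = ennreal (norm (integral\<^sup>L lborel (\<lambda>x. indicator {l i .. u i} x *\<^sub>R q x)))"
      using hb by (simp add: has_bochner_integral_iff)
    also have "\<dots> \<le> (\<integral>\<^sup>+x. ennreal (norm (indicator {l i .. u i} x *\<^sub>R q x)) \<partial>lborel)"
      using hb by (intro integral_norm_bound_ennreal) (simp add: has_bochner_integral_iff)
    also have "\<dots> \<le> ?I"
      using sub by (intro nn_integral_mono) (auto split: split_indicator)
    finally show ?thesis .
  qed
  have mem: "l i \<in> {\<alpha>..\<beta>}" "u i \<in> {\<alpha>..\<beta>}" for i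
    using ul(2-4)[of i] by auto
  have "(\<lambda>i. f (l i)) \<longlonglongrightarrow> f \<alpha>"
    using ul(5) mem \<open>\<alpha> < \<beta>\<close> by (intro continuous_on_tendsto_compose[OF f]) auto
  moreover have "(\<lambda>i. f (u i)) \<longlonglongrightarrow> f \<beta>"
    using ul(6) mem \<open>\<alpha> < \<beta>\<close> by (intro continuous_on_tendsto_compose[OF f]) auto
  ultimately have "(\<lambda>i. ennreal \<bar>f (u i) - f (l i)\<bar>) \<longlonglongrightarrow> ennreal \<bar>f \<beta> - f \<alpha>\<bar>"
    by (intro tendsto_intros)
  then show ?thesis
    by (rule LIMSEQ_le_const2) (use le in auto)
qed

text \<open>
  Cauchy--Schwarz for the factorisation \<open>r = (r / \<surd>G) \<surd>G\<close>.
\<close>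

lemma nn_integral_weighted_Cauchy_Schwarz:
  fixes r G :: "'a \<Rightarrow> ennreal"
  assumes [measurable]: "r \<in> borel_measurable M" "G \<in> borel_measurable M" "A \<in> sets M"
    and G: "AE x in M. x \<in> A \<longrightarrow> 0 < G x \<and> G x < top"
  shows "(\<integral>\<^sup>+x\<in>A. r x \<partial>M)\<^sup>2 \<le> (\<integral>\<^sup>+x\<in>A. (r x)\<^sup>2 / G x \<partial>M) * (\<integral>\<^sup>+x\<in>A. G x \<partial>M)"
proof -
  define w where "w x = ennreal (sqrt (enn2real (G x)))" for x
  have [measurable]: "w \<in> borel_measurable M"
    unfolding w_def by measurable
  have sq: "(w x)\<^sup>2 = G x" if "G x < top" for x
    using that by (cases "G x") (auto simp: w_def ennreal_power)
  have sq': "(r x / w x)\<^sup>2 = (r x)\<^sup>2 / G x" if "G x < top" for x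
    unfolding divide_ennreal_def power_mult_distrib ennreal_inverse_power[symmetric] sq[OF that] ..
  have w0: "0 < w x" "w x < top" if "0 < G x" "G x < top" for x
    using that by (cases "G x"; auto simp: w_def ennreal_less_top)+
  have eq1: "r x * indicator A x = (r x / w x * indicator A x) * (w x * indicator A x)"
    if "x \<in> A \<longrightarrow> 0 < G x \<and> G x < top" for x
  proof (cases "x \<in> A")
    case True
    then have "w x * (r x / w x) = r x"
      using that by (intro ennreal_mult_divide_cancel w0) simp_all
    with True show ?thesis by (simp add: mult.commute)
  qed simp
  have eq2: "(w x * indicator A x)\<^sup>2 = G x * indicator A x"
    and eq3: "(r x / w x * indicator A x)\<^sup>2 = (r x)\<^sup>2 / G x * indicator A x"
    if "x \<in> A \<longrightarrow> 0 < G x \<and> G x < top" for x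
    using that sq[of x] sq'[of x] by (cases "x \<in> A"; simp)+
  have "(\<integral>\<^sup>+x\<in>A. r x \<partial>M) = (\<integral>\<^sup>+x. (r x / w x * indicator A x) * (w x * indicator A x) \<partial>M)"
    by (intro nn_integral_cong_AE eventually_mono[OF G] eq1)
  also have "\<dots>\<^sup>2 \<le> (\<integral>\<^sup>+x. (r x / w x * indicator A x)\<^sup>2 \<partial>M) * (\<integral>\<^sup>+x. (w x * indicator A x)\<^sup>2 \<partial>M)"
    by (rule Cauchy_Schwarz_nn_integral) measurable
  also have "(\<integral>\<^sup>+x. (w x * indicator A x)\<^sup>2 \<partial>M) = (\<integral>\<^sup>+x\<in>A. G x \<partial>M)"
    by (intro nn_integral_cong_AE eventually_mono[OF G] eq2)
  also have "(\<integral>\<^sup>+x. (r x / w x * indicator A x)\<^sup>2 \<partial>M) = (\<integral>\<^sup>+x\<in>A. (r x)\<^sup>2 / G x \<partial>M)"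
    by (intro nn_integral_cong_AE eventually_mono[OF G] eq3)
  finally show ?thesis .
qed

section \<open>Primitives and tails of a pair of measures\<close>

text \<open>
  The measure \<open>\<nu>\<close> has the continuous positive density \<open>p\<close>, which makes primitives differentiable.
  The density is given on the whole line, so that this also holds at \<open>0\<close>. The measure \<open>\<mu>\<close> is
  represented by a general finite measure \<open>M\<close> on \<open>(0,D)\<close>: the absence of atoms makes tails
  continuous, and the positivity of \<open>M(s,D)\<close> makes them positive.
\<close>

locale hardy_weights =
  fixes D :: ereal and p :: "real \<Rightarrow> real" and M :: "real measure"
  assumes p_cont: "continuous_on UNIV p"
    and p_pos: "\<And>x. 0 < p x"
    and sets_M [measurable_cong, simp]: "sets M = sets borel"
    and M_finite: "emeasure M UNIV < top"
    and M_concentrated: "AE u in M. u \<in> einterval 0 D"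
    and M_atomless: "\<And>x. emeasure M {x} = 0"
    and M_tail_pos: "\<And>s. ereal s < D \<Longrightarrow> 0 < emeasure M (einterval (ereal s) D)"
begin

abbreviation "I \<equiv> einterval 0 D"

definition N :: "real measure" where
  "N = density lborel (\<lambda>x. ennreal (p x) * indicator I x)"

definition prim :: "(real \<Rightarrow> ennreal) \<Rightarrow> real \<Rightarrow> ennreal" where
  "prim h x = (\<integral>\<^sup>+s\<in>{0<..<x}. h s \<partial>N)"

definition tail :: "(real \<Rightarrow> ennreal) \<Rightarrow> real \<Rightarrow> ennreal" where
  "tail f s = (\<integral>\<^sup>+u\<in>einterval (ereal s) D. f u \<partial>M)"

text \<open>
  The real-valued version of the scale function \<open>\<phi>(x) = \<nu>(0,x)\<close>.
\<close>

definition \<Phi> :: "real \<Rightarrow> real" where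
  "\<Phi> x = (LBINT t=0..x. p t)"

lemma space_M [simp]: "space M = UNIV"
  using sets_eq_imp_space_eq[OF sets_M] by (simp only: space_borel)

sublocale M: finite_measure M
  by (rule finite_measureI) (use M_finite in \<open>simp add: less_top\<close>)

lemma p_measurable [measurable]: "p \<in> borel_measurable borel"
  using p_cont by (rule borel_measurable_continuous_onI)

lemma sets_N [measurable_cong, simp]: "sets N = sets borel" and space_N [simp]: "space N = UNIV"
  by (simp_all add: N_def)

sublocale N: sigma_finite_measure N
proof -
  have "AE x in lborel. ennreal (p x) * indicator I x \<noteq> \<infinity>"
    by (simp add: indicator_def)
  then show "sigma_finite_measure N"
    unfolding N_def using lborel.sigma_finite_measure_axioms
    by (subst sigma_finite_measure.sigma_finite_iff_density_finite) measurable
qed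

sublocale NM: pair_sigma_finite N M ..

lemma D_gt_0: "x \<in> I \<Longrightarrow> 0 < x" and less_D: "x \<in> I \<Longrightarrow> ereal x < D"
  by (auto simp: einterval_iff)

lemma le_D: "x \<in> I \<Longrightarrow> ereal x \<le> D"
  by (simp add: less_D less_imp_le)

lemma I_down: "x \<in> I \<Longrightarrow> 0 < y \<Longrightarrow> y \<le> x \<Longrightarrow> y \<in> I"
  using le_less_trans[of "ereal y" "ereal x" D] by (auto simp: einterval_iff)

lemma min_in_I: "x \<in> I \<Longrightarrow> y \<in> I \<Longrightarrow> min x y \<in> I"
  by (simp add: min_def)

lemma N_concentrated: "AE s in N. s \<in> I"
  unfolding N_def by (subst AE_density) (auto split: split_indicator)

lemma nn_integral_N:
  assumes [measurable]: "h \<in> borel_measurable borel"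
  shows "(\<integral>\<^sup>+s. h s \<partial>N) = (\<integral>\<^sup>+s\<in>I. h s * ennreal (p s) \<partial>lborel)"
  unfolding N_def by (subst nn_integral_density) (auto simp: mult_ac)

lemma prim_lborel:
  assumes [measurable]: "h \<in> borel_measurable borel" and "ereal x \<le> D"
  shows "prim h x = (\<integral>\<^sup>+s\<in>{0<..<x}. h s * ennreal (p s) \<partial>lborel)"
proof -
  have "h s * indicator {0<..<x} s * ennreal (p s) * indicator I s = h s * ennreal (p s) * indicator {0<..<x} s" for s
  proof (cases "s \<in> {0<..<x}")
    case True
    then have "s \<in> I"
      using less_le_trans[OF _ \<open>ereal x \<le> D\<close>, of "ereal s"] by (simp add: einterval_iff)
    with True show ?thesis by simp
  qed simp
  then show ?thesis
    unfolding prim_def by (subst nn_integral_N) simp_all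
qed

lemma prim_measurable [measurable]:
  assumes [measurable]: "h \<in> borel_measurable borel"
  shows "prim h \<in> borel_measurable borel"
  unfolding prim_def greaterThanLessThan_iff indicator_def by measurable

lemma tail_measurable [measurable]:
  assumes [measurable]: "f \<in> borel_measurable borel"
  shows "tail f \<in> borel_measurable borel"
  unfolding tail_def einterval_iff indicator_def by measurable

lemma tail_antimono: "s \<le> t \<Longrightarrow> tail f t \<le> tail f s"
  unfolding tail_def
  by (intro nn_integral_mono) (auto split: split_indicator simp: einterval_iff intro: le_less_trans[of "ereal s" "ereal t"])

lemma tail_mono: "(\<And>u. u \<in> I \<Longrightarrow> f u \<le> g u) \<Longrightarrow> tail f s \<le> tail g s"
  unfolding tail_def using M_concentrated
  by (intro nn_integral_mono_AE) (auto split: split_indicator elim!: eventually_mono)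

lemma tail_cmult:
  assumes [measurable]: "f \<in> borel_measurable borel"
  shows "tail (\<lambda>u. c * f u) s = c * tail f s"
  unfolding tail_def by (subst nn_integral_cmult[symmetric]) (auto simp: mult_ac)

lemma prim_mono: "(\<And>s. s \<in> I \<Longrightarrow> s < x \<Longrightarrow> g s \<le> h s) \<Longrightarrow> prim g x \<le> prim h x"
  unfolding prim_def using N_concentrated
  by (intro nn_integral_mono_AE) (auto split: split_indicator elim!: eventually_mono)

lemma prim_mono_right: "x \<le> y \<Longrightarrow> prim h x \<le> prim h y"
  unfolding prim_def by (intro nn_integral_mono) (auto split: split_indicator)

lemma prim_cmult:
  assumes [measurable]: "h \<in> borel_measurable borel"
  shows "prim (\<lambda>s. c * h s) x = c * prim h x"
  unfolding prim_def by (subst nn_integral_cmult[symmetric]) (auto simp: mult_ac)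

lemma prim_pos:
  assumes [measurable]: "h \<in> borel_measurable borel" and x: "x \<in> I"
    and "\<And>s. s \<in> I \<Longrightarrow> s < x \<Longrightarrow> 0 < h s"
  shows "0 < prim h x"
proof -
  have "0 < (\<integral>\<^sup>+s\<in>einterval 0 (ereal x). h s * ennreal (p s) \<partial>lborel)"
  proof (rule nn_integral_einterval_pos)
    fix s assume "s \<in> einterval 0 (ereal x)"
    then have "0 < s" "s < x" by (auto simp: einterval_iff)
    then show "0 < h s * ennreal (p s)"
      using assms(3)[of s] p_pos[of s] I_down[OF x, of s] by (simp add: ennreal_zero_less_mult_iff)
  qed (use D_gt_0[OF x] in auto)
  also have "einterval 0 (ereal x) = {0<..<x}"
    by (simp add: zero_ereal_def)
  finally show ?thesis
    by (simp add: prim_lborel le_D[OF x])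
qed

lemma tail_pos:
  assumes [measurable]: "f \<in> borel_measurable borel" and s: "s \<in> I"
    and "\<And>u. u \<in> I \<Longrightarrow> 0 < f u"
  shows "0 < tail f s"
proof (rule ccontr)
  assume "\<not> ?thesis"
  then have "AE u in M. f u * indicator (einterval (ereal s) D) u = 0"
    unfolding tail_def by (subst (asm) not_less, subst (asm) le_zero_eq, subst (asm) nn_integral_0_iff_AE) auto
  then have "AE u in M. u \<notin> einterval (ereal s) D"
    using M_concentrated by eventually_elim (use assms(3) in \<open>force split: split_indicator_asm\<close>)
  then have "emeasure M (einterval (ereal s) D) = 0"
    by (subst (asm) AE_iff_measurable[where N="einterval (ereal s) D"]) auto
  then show False
    using M_tail_pos[OF less_D[OF s]] by simp
qed

text \<open>
  Tonelli's theorem for the domain \<open>0 < s < u < D\<close>: primitive and tail are adjoint to each other.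
\<close>

lemma nn_integral_mult_tail:
  assumes [measurable]: "h \<in> borel_measurable borel" "f \<in> borel_measurable borel"
  shows "(\<integral>\<^sup>+s. h s * tail f s \<partial>N) = (\<integral>\<^sup>+u. f u * prim h u \<partial>M)"
proof -
  have "(\<integral>\<^sup>+s. h s * tail f s \<partial>N) = (\<integral>\<^sup>+s. (\<integral>\<^sup>+u. h s * (f u * indicator (einterval (ereal s) D) u) \<partial>M) \<partial>N)"
    unfolding tail_def by (intro nn_integral_cong nn_integral_cmult[symmetric]) auto
  also have "\<dots> = (\<integral>\<^sup>+u. (\<integral>\<^sup>+s. h s * (f u * indicator (einterval (ereal s) D) u) \<partial>N) \<partial>M)"
    by (rule NM.Fubini'[symmetric]) (simp add: einterval_iff indicator_def)
  also have "\<dots> = (\<integral>\<^sup>+u. f u * prim h u \<partial>M)"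
  proof (rule nn_integral_cong_AE)
    show "AE u in M. (\<integral>\<^sup>+s. h s * (f u * indicator (einterval (ereal s) D) u) \<partial>N) = f u * prim h u"
      using M_concentrated
    proof eventually_elim
      case (elim u)
      have ind: "(indicator (einterval (ereal s) D) u :: ennreal) = indicator {0<..<u} s" if "s \<in> I" for s
        using D_gt_0[OF that] less_D[OF elim] by (simp add: indicator_def einterval_iff)
      have "(\<integral>\<^sup>+s. h s * (f u * indicator (einterval (ereal s) D) u) \<partial>N)
          = (\<integral>\<^sup>+s. f u * (h s * indicator {0<..<u} s) \<partial>N)"
        by (intro nn_integral_cong_AE, use N_concentrated in eventually_elim)
           (simp only: ind mult.left_commute)
      also have "\<dots> = f u * prim h u"
        unfolding prim_def by (rule nn_integral_cmult) measurable
      finally show ?case .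
    qed
  qed
  finally show ?thesis .
qed

text \<open>
  The adjointness applied to \<open>h\<close> cut off at \<open>x\<close>: its primitive is the primitive of \<open>h\<close> stopped at \<open>x\<close>.
\<close>

lemma prim_mult_tail:
  assumes [measurable]: "h \<in> borel_measurable borel" "f \<in> borel_measurable borel"
  shows "prim (\<lambda>s. h s * tail f s) x = (\<integral>\<^sup>+u. f u * prim h (min u x) \<partial>M)"
proof -
  have "prim (\<lambda>s. h s * tail f s) x = (\<integral>\<^sup>+s. (h s * indicator {0<..<x} s) * tail f s \<partial>N)"
    unfolding prim_def by (simp add: mult_ac)
  also have "\<dots> = (\<integral>\<^sup>+u. f u * prim (\<lambda>s. h s * indicator {0<..<x} s) u \<partial>M)"
    by (rule nn_integral_mult_tail) auto
  also have "(\<lambda>u. prim (\<lambda>s. h s * indicator {0<..<x} s) u) = (\<lambda>u. prim h (min u x))"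
    unfolding prim_def by (intro ext nn_integral_cong) (auto split: split_indicator)
  finally show ?thesis .
qed

lemma Phi_deriv: "(\<Phi> has_real_derivative p x) (at x)"
  unfolding \<Phi>_def[abs_def] by (rule has_real_derivative_LBINT_from_0[OF p_cont])

lemma Phi_0: "\<Phi> 0 = 0"
  by (simp add: \<Phi>_def zero_ereal_def[symmetric])

lemma Phi_strict_mono: "x < y \<Longrightarrow> \<Phi> x < \<Phi> y"
  by (rule DERIV_pos_imp_increasing) (use Phi_deriv p_pos in blast)+

lemma Phi_pos: "0 < x \<Longrightarrow> 0 < \<Phi> x"
  using Phi_strict_mono[of 0 x] Phi_0 by simp

lemma Phi_measurable [measurable]: "\<Phi> \<in> borel_measurable borel"
  using Phi_deriv by (intro borel_measurable_continuous_onI DERIV_continuous_on)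
    (auto intro: has_field_derivative_at_within)

lemma prim_1: "x \<in> I \<Longrightarrow> prim (\<lambda>_. 1) x = ennreal (\<Phi> x)"
  using nn_integral_eq_LBINT_from_0[OF p_cont less_imp_le[OF p_pos] less_imp_le[OF D_gt_0], of x]
  by (simp add: prim_lborel le_D \<Phi>_def)

lemma tail_finite:
  assumes "(\<integral>\<^sup>+u. f u \<partial>M) < top"
  shows "tail f s < top"
proof -
  have "tail f s \<le> (\<integral>\<^sup>+u. f u \<partial>M)"
    unfolding tail_def by (intro nn_integral_mono) (simp add: indicator_def)
  then show ?thesis using assms by (rule order_le_less_trans)
qed

text \<open>
  The point \<open>s\<close> is the only place where the indicators of \<open>(s\<^sub>n,D)\<close> may fail to converge to that of
  \<open>(s,D)\<close>, and it carries no mass.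
\<close>

lemma continuous_on_tail:
  assumes [measurable]: "f \<in> borel_measurable borel" and fin: "(\<integral>\<^sup>+u. f u \<partial>M) < top"
  shows "continuous_on UNIV (tail f)"
proof (rule continuous_at_imp_continuous_on, rule ballI)
  fix s :: real
  show "isCont (tail f) s"
    unfolding continuous_at_sequentially comp_def
  proof (intro allI impI)
    fix X :: "nat \<Rightarrow> real" assume X: "X \<longlonglongrightarrow> s"
    show "(\<lambda>n. tail f (X n)) \<longlonglongrightarrow> tail f s"
      unfolding tail_def
    proof (rule nn_integral_dominated_convergence[where w=f])
      have "AE u in M. u \<notin> {s}"
        by (rule AE_not_in) (simp add: null_sets_def M_atomless)
      then show "AE u in M. (\<lambda>n. f u * indicator (einterval (ereal (X n)) D) u) \<longlonglongrightarrow> f u * indicator (einterval (ereal s) D) u"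
      proof eventually_elim
        case (elim u)
        have ev: "eventually (\<lambda>n. (X n < u) = (s < u)) sequentially"
        proof (cases "s < u")
          case True
          then show ?thesis using order_tendstoD(2)[OF X, of u] by simp
        next
          case False
          then have "u < s" using elim by simp
          then show ?thesis
            using order_tendstoD(1)[OF X, of u] by (auto elim!: eventually_mono)
        qed
        show ?case
          by (rule tendsto_eventually, rule eventually_mono[OF ev]) (simp add: indicator_def einterval_iff)
      qed
    qed (use fin in \<open>auto simp: indicator_def\<close>)
  qed
qed

text \<open>
  A tail is decreasing, hence so are its averages \<open>P(T f)(x) / \<phi>(x)\<close>. The inequality is stated after
  multiplication with the denominators.
\<close>

lemma prim_tail_average_antimono:
  assumes [measurable]: "f \<in> borel_measurable borel" and "0 < x" "x \<le> y"
  shows "prim (\<lambda>_. 1) x * prim (tail f) y \<le> prim (\<lambda>_. 1) y * prim (tail f) x"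
proof -
  define R where "R h = (\<integral>\<^sup>+s\<in>{x..<y}. h s \<partial>N)" for h :: "real \<Rightarrow> ennreal"
  have split: "prim h y = prim h x + R h" if [measurable]: "h \<in> borel_measurable borel" for h
    unfolding prim_def R_def using assms(2,3)
    by (subst nn_integral_add[symmetric]) (auto intro!: nn_integral_cong simp: indicator_def)
  have "R (tail f) \<le> (\<integral>\<^sup>+s. tail f x * (1 * indicator {x..<y} s) \<partial>N)"
    unfolding R_def by (intro nn_integral_mono) (simp add: indicator_def tail_antimono)
  also have "\<dots> = tail f x * R (\<lambda>_. 1)"
    unfolding R_def by (rule nn_integral_cmult) measurable
  finally have R_le: "R (tail f) \<le> tail f x * R (\<lambda>_. 1)" .
  have "prim (\<lambda>_. tail f x * 1) x \<le> prim (tail f) x"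
    by (rule prim_mono) (simp add: tail_antimono)
  then have prim_ge: "tail f x * prim (\<lambda>_. 1) x \<le> prim (tail f) x"
    by (subst (asm) prim_cmult) simp_all
  have "prim (\<lambda>_. 1) x * prim (tail f) y = prim (\<lambda>_. 1) x * prim (tail f) x + prim (\<lambda>_. 1) x * R (tail f)"
    using split[of "tail f"] by (simp add: distrib_left)
  also have "prim (\<lambda>_. 1) x * R (tail f) \<le> prim (\<lambda>_. 1) x * (tail f x * R (\<lambda>_. 1))"
    using R_le by (rule mult_left_mono) simp
  also have "\<dots> \<le> prim (tail f) x * R (\<lambda>_. 1)"
    using mult_right_mono[OF prim_ge, of "R (\<lambda>_. 1)"] by (simp add: mult_ac)
  also have "prim (\<lambda>_. 1) x * prim (tail f) x + prim (tail f) x * R (\<lambda>_. 1) = prim (\<lambda>_. 1) y * prim (tail f) x"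
    using split[of "\<lambda>_. 1"] by (simp add: algebra_simps)
  finally show ?thesis
    by (simp add: add_left_mono)
qed

section \<open>A criterion for the weighted Hardy inequality\<close>

text \<open>
  If the tail were infinite at \<open>x\<close>, it would be infinite on all of \<open>(0,x)\<close>, where \<open>N\<close> has positive mass.
\<close>

lemma tail_finite_if_prim_tail_finite:
  assumes x: "x \<in> I" and "prim (tail f) x < top"
  shows "tail f x < top"
proof (rule ccontr)
  assume "\<not> ?thesis"
  then have "tail f x = top" by (meson top.not_eq_extremum)
  then have top: "tail f s = top" if "s < x" for s
    using tail_antimono[OF less_imp_le[OF that], of f] by (simp add: top_unique)
  have "prim (\<lambda>_. top * 1) x \<le> prim (tail f) x"
    by (rule prim_mono) (simp add: top)
  then have "top * prim (\<lambda>_. 1) x \<le> prim (tail f) x"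
    by (subst (asm) prim_cmult) auto
  moreover have "0 < prim (\<lambda>_. 1) x"
    using x by (simp add: prim_1 Phi_pos D_gt_0)
  ultimately show False
    using assms(2) by (simp add: ennreal_top_mult top_unique split: if_splits)
qed

text \<open>
  This is Schur's test for the operator \<open>P\<close>: a positive function \<open>g\<close> with \<open>P(T g) \<le> K g\<close> bounds the
  squared norm of \<open>P\<close> from \<open>L\<^sup>2(\<nu>)\<close> to \<open>L\<^sup>2(\<mu>)\<close> by \<open>K\<close>.
\<close>

theorem Hardy_if_prim_tail_le:
  fixes g r :: "real \<Rightarrow> ennreal" and K :: ennreal
  assumes [measurable]: "g \<in> borel_measurable borel" "r \<in> borel_measurable borel"
    and g: "\<And>x. x \<in> I \<Longrightarrow> 0 < g x \<and> g x < top"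
    and K: "K < top" "\<And>x. x \<in> I \<Longrightarrow> prim (tail g) x \<le> K * g x"
  shows "(\<integral>\<^sup>+x. (prim r x)\<^sup>2 \<partial>M) \<le> K * (\<integral>\<^sup>+s. (r s)\<^sup>2 \<partial>N)"
proof -
  let ?G = "tail g"
  have G: "0 < ?G s \<and> ?G s < top" if "s \<in> I" for s
  proof -
    have "prim ?G s < top"
      using K(2)[OF that] g[OF that] K(1) by (metis ennreal_mult_less_top order_le_less_trans)
    then show ?thesis
      using that g by (auto intro: tail_pos tail_finite_if_prim_tail_finite)
  qed
  have "(\<integral>\<^sup>+x. (prim r x)\<^sup>2 \<partial>M) \<le> (\<integral>\<^sup>+x. K * (g x * prim (\<lambda>s. (r s)\<^sup>2 / ?G s) x) \<partial>M)"
  proof (intro nn_integral_mono_AE, use M_concentrated in eventually_elim)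
    case (elim x)
    have "(prim r x)\<^sup>2 \<le> prim (\<lambda>s. (r s)\<^sup>2 / ?G s) x * prim ?G x"
      unfolding prim_def
      by (intro nn_integral_weighted_Cauchy_Schwarz)
         (use N_concentrated G in \<open>auto elim: eventually_mono\<close>)
    also have "\<dots> \<le> prim (\<lambda>s. (r s)\<^sup>2 / ?G s) x * (K * g x)"
      using K(2)[OF elim] by (rule mult_left_mono) simp
    finally show ?case by (simp add: mult_ac)
  qed
  also have "\<dots> = K * (\<integral>\<^sup>+s. (r s)\<^sup>2 / ?G s * ?G s \<partial>N)"
    by (subst nn_integral_cmult) (auto simp: nn_integral_mult_tail)
  also have "(\<integral>\<^sup>+s. (r s)\<^sup>2 / ?G s * ?G s \<partial>N) \<le> (\<integral>\<^sup>+s. (r s)\<^sup>2 \<partial>N)"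
    by (intro nn_integral_mono ennreal_divide_mult_le)
  finally show ?thesis
    by (simp add: mult_left_mono)
qed

section \<open>The square root of the scale function\<close>

lemma nn_integral_deriv_sqrt_Phi:
  assumes "0 < s" "s \<le> u"
  shows "(\<integral>\<^sup>+t\<in>{s..u}. ennreal (p t / (2 * sqrt (\<Phi> t))) \<partial>lborel) = ennreal (sqrt (\<Phi> u) - sqrt (\<Phi> s))"
proof (rule nn_integral_FTC_Icc)
  fix x assume "x \<in> {s..u}"
  then have "0 < \<Phi> x" using assms by (intro Phi_pos) simp
  then show "((\<lambda>x. sqrt (\<Phi> x)) has_real_derivative p x / (2 * sqrt (\<Phi> x))) (at x)" "0 \<le> p x / (2 * sqrt (\<Phi> x))"
    using p_pos[of x] by (auto intro!: derivative_eq_intros Phi_deriv simp: field_simps)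
qed (use assms in auto)

lemma nn_integral_deriv_inverse_sqrt_Phi:
  assumes "0 < s" "s \<le> u"
  shows "(\<integral>\<^sup>+t\<in>{s..u}. ennreal (p t / (2 * sqrt (\<Phi> t)) / \<Phi> t) \<partial>lborel)
    = ennreal (- inverse (sqrt (\<Phi> u)) - - inverse (sqrt (\<Phi> s)))"
proof (rule nn_integral_FTC_Icc)
  fix x assume "x \<in> {s..u}"
  then have "0 < \<Phi> x" using assms by (intro Phi_pos) simp
  then show "DERIV (\<lambda>x. - inverse (sqrt (\<Phi> x))) x :> p x / (2 * sqrt (\<Phi> x)) / \<Phi> x"
     "0 \<le> p x / (2 * sqrt (\<Phi> x)) / \<Phi> x"
    using p_pos[of x] by (auto intro!: derivative_eq_intros Phi_deriv simp: field_simps power2_eq_square)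
qed (use assms in auto)

text \<open>
  Write \<open>\<surd>\<phi>(u) = \<surd>\<phi>(s) + \<integral>\<^sub>s\<^sup>u d\<surd>\<phi>\<close> and exchange the integrals. Both resulting terms,
  \<open>\<surd>\<phi>(s) \<mu>(s,D)\<close> and \<open>\<integral>\<^sub>s\<^sup>D \<mu>(t,D) d\<surd>\<phi>(t)\<close>, are at most \<open>B / \<surd>\<phi>(s)\<close>, the second one because
  \<open>d\<surd>\<phi> / \<phi>\<close> is the differential of \<open>- 1 / \<surd>\<phi>\<close>.
\<close>

lemma tail_sqrt_Phi_le:
  assumes B: "\<And>x. x \<in> I \<Longrightarrow> ennreal (\<Phi> x) * emeasure M (einterval (ereal x) D) \<le> B"
    and s: "s \<in> I"
  shows "tail (\<lambda>u. ennreal (sqrt (\<Phi> u))) s \<le> 2 * B * ennreal (1 / sqrt (\<Phi> s))"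
proof -
  define h where "h t = ennreal (1 / (2 * sqrt (\<Phi> t))) * indicator {s<..} t" for t
  have [measurable]: "h \<in> borel_measurable borel"
    unfolding h_def by measurable
  have hp: "ennreal (1 / (2 * sqrt (\<Phi> t))) * ennreal (p t) = ennreal (p t / (2 * sqrt (\<Phi> t)))" if "0 < t" for t
    using Phi_pos[OF that] p_pos[of t] by (simp add: ennreal_mult[symmetric])
  have M_le: "emeasure M (einterval (ereal t) D) \<le> B * ennreal (1 / \<Phi> t)" if "t \<in> I" for t
  proof -
    have P: "0 < \<Phi> t" using that by (simp add: Phi_pos D_gt_0)
    have "emeasure M (einterval (ereal t) D) = ennreal (1 / \<Phi> t) * (ennreal (\<Phi> t) * emeasure M (einterval (ereal t) D))"
      using P by (subst mult.assoc[symmetric], subst ennreal_mult[symmetric]) auto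
    also have "\<dots> \<le> ennreal (1 / \<Phi> t) * B"
      using B[OF that] by (rule mult_left_mono) simp
    finally show ?thesis by (simp add: mult.commute)
  qed
  have t_pos: "0 < t" if "s < t" for t
    using D_gt_0[OF s] that by (rule less_trans)
  have sqrt_eq: "ennreal (sqrt (\<Phi> u)) = ennreal (sqrt (\<Phi> s)) + prim h u" if "s < u" "u \<in> I" for u
  proof -
    have "prim h u = (\<integral>\<^sup>+t\<in>{s<..<u}. ennreal (p t / (2 * sqrt (\<Phi> t))) \<partial>lborel)"
      using that unfolding h_def
      by (subst prim_lborel) (auto simp: le_D intro!: nn_integral_cong split: split_indicator simp: hp t_pos)
    also have "\<dots> = ennreal (sqrt (\<Phi> u) - sqrt (\<Phi> s))"
      using that s by (simp add: nn_integral_Ioo_eq_Icc nn_integral_deriv_sqrt_Phi D_gt_0)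
    finally show ?thesis
      using Phi_strict_mono[OF \<open>s < u\<close>] Phi_pos[OF D_gt_0[OF s]]
      by (simp add: ennreal_plus[symmetric] del: ennreal_plus)
  qed
  have "tail (\<lambda>u. ennreal (sqrt (\<Phi> u))) s
      = (\<integral>\<^sup>+u. ennreal (sqrt (\<Phi> s)) * indicator (einterval (ereal s) D) u + prim h u * indicator (einterval (ereal s) D) u \<partial>M)"
    unfolding tail_def using s
    by (intro nn_integral_cong) (auto split: split_indicator simp: sqrt_eq einterval_iff less_trans[of 0 "ereal s"])
  also have "\<dots> = ennreal (sqrt (\<Phi> s)) * emeasure M (einterval (ereal s) D)
      + (\<integral>\<^sup>+u\<in>einterval (ereal s) D. prim h u \<partial>M)"
    by (subst nn_integral_add) (auto simp: nn_integral_cmult)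
  also have "ennreal (sqrt (\<Phi> s)) * emeasure M (einterval (ereal s) D) \<le> B * ennreal (1 / sqrt (\<Phi> s))"
  proof -
    have P: "0 < \<Phi> s" using s by (simp add: Phi_pos D_gt_0)
    have "ennreal (sqrt (\<Phi> s)) * emeasure M (einterval (ereal s) D) \<le> ennreal (sqrt (\<Phi> s)) * (B * ennreal (1 / \<Phi> s))"
      using M_le[OF s] by (rule mult_left_mono) simp
    also have "\<dots> = B * ennreal (sqrt (\<Phi> s) * (1 / \<Phi> s))"
      using P by (subst ennreal_mult) (auto simp: mult_ac)
    also have "sqrt (\<Phi> s) * (1 / \<Phi> s) = 1 / sqrt (\<Phi> s)"
      using P by (simp add: field_simps)
    finally show ?thesis .
  qed
  also have "(\<integral>\<^sup>+u\<in>einterval (ereal s) D. prim h u \<partial>M) \<le> (\<integral>\<^sup>+u. 1 * prim h u \<partial>M)"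
    by (intro nn_integral_mono) (auto split: split_indicator)
  also have "\<dots> = (\<integral>\<^sup>+t. h t * tail (\<lambda>_. 1) t \<partial>N)"
    by (rule nn_integral_mult_tail[symmetric]) auto
  also have "\<dots> \<le> (\<integral>\<^sup>+t\<in>einterval (ereal s) D. B * ennreal (p t / (2 * sqrt (\<Phi> t)) / \<Phi> t) \<partial>lborel)"
  proof (subst nn_integral_N, measurable, intro nn_integral_mono)
    fix t
    show "h t * tail (\<lambda>_. 1) t * ennreal (p t) * indicator I t
      \<le> B * ennreal (p t / (2 * sqrt (\<Phi> t)) / \<Phi> t) * indicator (einterval (ereal s) D) t"
    proof (cases "s < t \<and> t \<in> I")
      case True
      then have P: "0 < \<Phi> t" by (simp add: Phi_pos D_gt_0)
      have "h t * tail (\<lambda>_. 1) t * ennreal (p t) = ennreal (p t / (2 * sqrt (\<Phi> t))) * emeasure M (einterval (ereal t) D)"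
        using True by (simp add: h_def tail_def hp[symmetric] D_gt_0 mult_ac)
      also have "\<dots> \<le> ennreal (p t / (2 * sqrt (\<Phi> t))) * (B * ennreal (1 / \<Phi> t))"
        using True by (intro mult_left_mono M_le) auto
      also have "\<dots> = B * ennreal (p t / (2 * sqrt (\<Phi> t)) * (1 / \<Phi> t))"
        using P p_pos[of t] by (subst ennreal_mult) (auto simp: mult_ac)
      finally have "h t * tail (\<lambda>_. 1) t * ennreal (p t) \<le> B * ennreal (p t / (2 * sqrt (\<Phi> t)) / \<Phi> t)"
        by simp
      moreover have "t \<in> einterval (ereal s) D"
        using True less_D[of t] by (simp add: einterval_iff)
      ultimately show ?thesis
        using True by simp
    qed (auto simp: h_def split: split_indicator)
  qed
  also have "\<dots> = B * (\<integral>\<^sup>+t\<in>einterval (ereal s) D. ennreal (p t / (2 * sqrt (\<Phi> t)) / \<Phi> t) \<partial>lborel)"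
    by (subst nn_integral_cmult[symmetric]) (auto simp: mult_ac)
  also have "(\<integral>\<^sup>+t\<in>einterval (ereal s) D. ennreal (p t / (2 * sqrt (\<Phi> t)) / \<Phi> t) \<partial>lborel) \<le> ennreal (1 / sqrt (\<Phi> s))"
  proof (rule nn_integral_einterval_le_if_Icc)
    fix x y assume xy: "ereal s < ereal x" "x < y" "ereal y < D"
    then have *: "0 < \<Phi> s" "\<Phi> s < \<Phi> x" "\<Phi> x < \<Phi> y" "0 < x"
      using s D_gt_0[OF s] by (auto intro: Phi_pos Phi_strict_mono)
    show "(\<integral>\<^sup>+t\<in>{x..y}. ennreal (p t / (2 * sqrt (\<Phi> t)) / \<Phi> t) \<partial>lborel) \<le> ennreal (1 / sqrt (\<Phi> s))"
    proof (subst nn_integral_deriv_inverse_sqrt_Phi)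
      have "1 / sqrt (\<Phi> x) \<le> 1 / sqrt (\<Phi> s)" "0 \<le> 1 / sqrt (\<Phi> y)"
        using * by (auto intro!: frac_le)
      then show "ennreal (- inverse (sqrt (\<Phi> y)) - - inverse (sqrt (\<Phi> x))) \<le> ennreal (1 / sqrt (\<Phi> s))"
        unfolding inverse_eq_divide by (intro ennreal_leI) linarith
    qed (use * xy in auto)
  qed measurable
  finally show ?thesis
    by (simp add: add_mono mult_left_mono mult_2 distrib_right)
qed

text \<open>
  The preceding bound is integrated once more; \<open>1 / (2 \<surd>\<phi>)\<close> is the derivative of \<open>\<surd>\<phi>\<close> with respect
  to \<open>\<nu>\<close>, which accounts for the second factor two.
\<close>

theorem prim_tail_sqrt_Phi_le:
  assumes B: "\<And>x. x \<in> I \<Longrightarrow> ennreal (\<Phi> x) * emeasure M (einterval (ereal x) D) \<le> B"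
    and x: "x \<in> I"
  shows "prim (tail (\<lambda>u. ennreal (sqrt (\<Phi> u)))) x \<le> 4 * B * ennreal (sqrt (\<Phi> x))"
proof -
  have "prim (tail (\<lambda>u. ennreal (sqrt (\<Phi> u)))) x \<le> prim (\<lambda>s. (4 * B) * ennreal (1 / (2 * sqrt (\<Phi> s)))) x"
  proof (rule prim_mono)
    fix s assume s: "s \<in> I"
    have "4 * B * ennreal (1 / (2 * sqrt (\<Phi> s))) = 2 * B * (ennreal 2 * ennreal (1 / (2 * sqrt (\<Phi> s))))"
      by (simp add: mult_ac)
    also have "ennreal 2 * ennreal (1 / (2 * sqrt (\<Phi> s))) = ennreal (1 / sqrt (\<Phi> s))"
      using Phi_pos[OF D_gt_0[OF s]] by (subst ennreal_mult[symmetric]) auto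
    finally show "tail (\<lambda>u. ennreal (sqrt (\<Phi> u))) s \<le> (4 * B) * ennreal (1 / (2 * sqrt (\<Phi> s)))"
      using tail_sqrt_Phi_le[OF B s] by simp
  qed
  also have "\<dots> = 4 * B * prim (\<lambda>s. ennreal (1 / (2 * sqrt (\<Phi> s)))) x"
    by (rule prim_cmult) measurable
  also have "prim (\<lambda>s. ennreal (1 / (2 * sqrt (\<Phi> s)))) x
      = (\<integral>\<^sup>+s\<in>einterval 0 (ereal x). ennreal (p s / (2 * sqrt (\<Phi> s))) \<partial>lborel)"
    using x Phi_pos p_pos
    by (subst prim_lborel) (auto simp: le_D intro!: nn_integral_cong split: split_indicator
        simp: einterval_iff ennreal_mult[symmetric] less_imp_le)
  also have "\<dots> \<le> ennreal (sqrt (\<Phi> x))"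
  proof (rule nn_integral_einterval_le_if_Icc)
    fix l u :: real assume lu: "0 < ereal l" "l < u" "ereal u < ereal x"
    then have *: "0 < \<Phi> l" "\<Phi> u < \<Phi> x"
      by (auto intro: Phi_pos Phi_strict_mono)
    show "(\<integral>\<^sup>+t\<in>{l..u}. ennreal (p t / (2 * sqrt (\<Phi> t))) \<partial>lborel) \<le> ennreal (sqrt (\<Phi> x))"
      using lu * by (subst nn_integral_deriv_sqrt_Phi)
        (auto intro!: ennreal_leI intro: order_trans[of _ "sqrt (\<Phi> u)"])
  qed measurable
  finally show ?thesis
    by (simp add: mult_left_mono)
qed

end

section \<open>The diffusion and its two measures\<close>

locale diffusion =
  fixes a b :: "real \<Rightarrow> real" and D :: ereal
  assumes D_pos: "0 < D"
    and a_meas: "a \<in> borel_measurable (restrict_space borel (cinterval D))"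
    and a_pos: "\<And>x. x \<in> einterval 0 D \<Longrightarrow> 0 < a x"
    and ba_int: "locally_integrable_on (\<lambda>x. b x / a x) (cinterval D)"
    and mu_finite: "emeasure (mu a b D) (einterval 0 D) < \<infinity>"
begin

text \<open>
  The nearest point projection onto \<open>[0,D]\<close>. It extends \<open>C\<close> to a continuous function on the whole line,
  so that no integrand below needs a restriction to \<open>[0,D]\<close>.
\<close>

definition clamp :: "real \<Rightarrow> real" where
  "clamp x = max 0 (if D = \<infinity> then x else min x (real_of_ereal D))"

definition c :: "real \<Rightarrow> real" where
  "c x = C_fun a b (clamp x)"

lemma c_eq: "x \<in> einterval 0 D \<Longrightarrow> c x = C_fun a b x"
  unfolding c_def clamp_def by (cases D) (auto simp: einterval_iff)

lemma continuous_on_c: "continuous_on UNIV c"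
proof (rule continuous_at_imp_continuous_on, rule ballI)
  fix x :: real
  \<comment> \<open>For infinite \<open>D\<close> the projection coincides only locally with one onto a compact interval.\<close>
  obtain y where y: "0 \<le> y" "ereal y \<le> D" "\<And>z. z < x + 1 \<Longrightarrow> clamp z = max 0 (min z y)"
  proof (cases D)
    case (real r)
    then have "clamp z = max 0 (min z r)" for z
      unfolding clamp_def by simp
    with real D_pos show ?thesis
      by (intro that[of r]) simp_all
  next
    case PInf
    then have "clamp z = max 0 (min z (max 0 (x + 1)))" if "z < x + 1" for z
      unfolding clamp_def using that by auto
    with PInf show ?thesis
      by (intro that[of "max 0 (x + 1)"]) simp_all
  qed (use D_pos in auto)
  have "{0..y} \<subseteq> cinterval D"
    unfolding cinterval_def using y(2) by (auto intro: order_trans[of "ereal _" "ereal y"])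
  then have int: "set_integrable lborel {0..y} (\<lambda>u. b u / a u)"
    using ba_int unfolding locally_integrable_on_def by blast
  have "continuous_on {0..y} (\<lambda>x. integral {0..x} (\<lambda>u. b u / a u))"
    using set_borel_integral_eq_integral(1)[OF int] by (rule indefinite_integral_continuous_1)
  moreover have "integral {0..z} (\<lambda>u. b u / a u) = C_fun a b z" if "z \<in> {0..y}" for z
  proof -
    have "set_integrable lborel {0..z} (\<lambda>u. b u / a u)"
      using int by (rule set_integrable_subset) (use that in auto)
    then show ?thesis
      unfolding C_fun_def by (rule set_borel_integral_eq_integral(2)[symmetric])
  qed
  ultimately have "continuous_on {0..y} (C_fun a b)"
    by (rule continuous_on_eq)
  then have "continuous_on UNIV (\<lambda>z. C_fun a b (max 0 (min z y)))"
    by (rule continuous_on_compose2) (use y(1) in \<open>auto intro!: continuous_intros\<close>)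
  then have "isCont (\<lambda>z. C_fun a b (max 0 (min z y))) x"
    by (simp add: continuous_on_eq_continuous_at)
  moreover have "eventually (\<lambda>z. z < x + 1) (nhds x)"
    by (rule eventually_nhds_in_open[of "{..<x+1}" x, simplified])
  then have "eventually (\<lambda>z. C_fun a b (max 0 (min z y)) = c z) (nhds x)"
    by eventually_elim (simp add: c_def y(3))
  ultimately show "isCont c x"
    by (subst (asm) isCont_cong)
qed

lemma c_measurable [measurable]: "c \<in> borel_measurable borel"
  using continuous_on_c by (rule borel_measurable_continuous_onI)

definition p :: "real \<Rightarrow> real" where
  "p x = exp (- c x)"

text \<open>
  The coefficient \<open>a\<close> is measurable on \<open>[0,D]\<close> only; this version is Borel measurable on the line.
\<close>

definition aI :: "real \<Rightarrow> real" where
  "aI x = indicator (einterval 0 D) x * a x"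

lemma aI_measurable [measurable]: "aI \<in> borel_measurable borel"
proof -
  have "einterval 0 D \<subseteq> cinterval D"
    by (auto simp: einterval_iff cinterval_def)
  then have "a \<in> borel_measurable (restrict_space borel (einterval 0 D))"
    using measurable_restrict_mono[OF a_meas] by blast
  then show ?thesis
    unfolding aI_def by (subst (asm) borel_measurable_restrict_space_iff) auto
qed

definition m :: "real \<Rightarrow> ennreal" where
  "m x = ennreal (exp (c x) / aI x) * indicator (einterval 0 D) x"

lemma m_measurable [measurable]: "m \<in> borel_measurable borel"
  unfolding m_def by measurable

lemma mu_eq: "mu a b D = density lborel m"
  unfolding mu_def m_def
  by (intro arg_cong[where f="density lborel"] ext) (auto simp: aI_def c_eq indicator_def)

lemma m_pos: "x \<in> einterval 0 D \<Longrightarrow> 0 < m x"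
  using a_pos[of x] by (simp add: m_def aI_def)

sublocale hardy_weights D p "mu a b D"
proof
  show "continuous_on UNIV p"
    unfolding p_def[abs_def] by (intro continuous_intros continuous_on_c)
  show "sets (mu a b D) = sets borel"
    by (simp add: mu_def)
  have "m x * indicator UNIV x = m x * indicator (einterval 0 D) x" for x
    by (simp add: m_def indicator_def)
  then show "emeasure (mu a b D) UNIV < top"
    using mu_finite by (simp add: mu_eq emeasure_density less_top)
  show "AE u in mu a b D. u \<in> einterval 0 D"
    unfolding mu_eq by (subst AE_density) (auto simp: m_def indicator_def)
  show "emeasure (mu a b D) {x} = 0" for x
  proof -
    have "AE t in lborel. m t * indicator {x} t = 0"
      using AE_lborel_singleton[of x] by eventually_elim simp
    then show ?thesis
      by (simp add: mu_eq emeasure_density nn_integral_0_iff_AE)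
  qed
  show "0 < emeasure (mu a b D) (einterval (ereal s) D)" if "ereal s < D" for s
  proof -
    have "0 < (\<integral>\<^sup>+t\<in>einterval (ereal (max 0 s)) D. m t \<partial>lborel)"
    proof (intro nn_integral_einterval_pos m_pos)
      show "ereal (max 0 s) < D"
        using that D_pos by (simp add: max_def zero_ereal_def)
    qed (auto simp: einterval_iff)
    also have "\<dots> \<le> (\<integral>\<^sup>+t\<in>einterval (ereal s) D. m t \<partial>lborel)"
      by (intro nn_integral_mono) (auto simp: indicator_def einterval_iff)
    finally show ?thesis
      by (simp add: mu_eq emeasure_density)
  qed
qed (simp add: p_def)

lemma nu_eq: "nu a b D = N"
  unfolding nu_def N_def p_def
  by (intro arg_cong[where f="density lborel"] ext) (auto simp: c_eq indicator_def)

lemma II_eq: "II a b D f x = prim (tail f) x / f x"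
  by (simp add: II_def prim_def tail_def nu_eq)

lemma phi_eq: "phi a b D x = prim (\<lambda>_. 1) x"
  by (simp add: phi_def prim_def nu_eq)

lemma mu_sq_eq: "mu_sq a b D f = (\<integral>\<^sup>+x. ennreal ((f x)\<^sup>2) \<partial>mu a b D)"
  unfolding mu_sq_def by (intro nn_integral_cong_AE eventually_mono[OF M_concentrated]) simp

text \<open>
  The function \<open>r\<close> is the derivative of \<open>f\<close> with respect to \<open>\<nu>\<close>. In \<open>a f'\<^sup>2 e\<^sup>C / a = r\<^sup>2 e\<^sup>-\<^sup>C\<close> the
  coefficient \<open>a\<close> cancels. The exceptional point \<open>z\<close>, where nothing is assumed about \<open>f\<close>, allows for
  functions stopped at \<open>z\<close>.
\<close>

lemma energy_eq:
  fixes f r :: "real \<Rightarrow> real"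
  assumes [measurable]: "r \<in> borel_measurable borel"
    and deriv: "\<And>x. x \<in> I \<Longrightarrow> x \<noteq> z \<Longrightarrow> (f has_real_derivative p x * r x) (at x)"
  shows "energy a b D f = (\<integral>\<^sup>+s. ennreal ((r s)\<^sup>2) \<partial>N)"
proof -
  have "AE x in mu a b D. x \<notin> {z}"
    by (rule AE_not_in) (simp add: null_sets_def M_atomless)
  then have "energy a b D f = (\<integral>\<^sup>+x. ennreal (aI x * (p x * r x)\<^sup>2) \<partial>mu a b D)"
    unfolding energy_def
    using M_concentrated
    by (intro nn_integral_cong_AE, eventually_elim) (simp add: aI_def DERIV_imp_deriv[OF deriv])
  also have "\<dots> = (\<integral>\<^sup>+x. m x * ennreal (aI x * (p x * r x)\<^sup>2) \<partial>lborel)"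
    unfolding mu_eq by (rule nn_integral_density) auto
  also have "(\<lambda>x. m x * ennreal (aI x * (p x * r x)\<^sup>2)) = (\<lambda>x. ennreal ((r x)\<^sup>2) * ennreal (p x) * indicator I x)"
  proof
    fix x
    show "m x * ennreal (aI x * (p x * r x)\<^sup>2) = ennreal ((r x)\<^sup>2) * ennreal (p x) * indicator I x"
    proof (cases "x \<in> I")
      case True
      then have "0 < aI x" using a_pos by (simp add: aI_def)
      then have "exp (c x) / aI x * (aI x * (p x * r x)\<^sup>2) = (r x)\<^sup>2 * p x"
        by (simp add: p_def power2_eq_square exp_minus field_simps)
      then show ?thesis
        using True \<open>0 < aI x\<close> p_pos[of x] by (simp add: m_def ennreal_mult[symmetric])
    qed (simp add: m_def)
  qed
  finally show ?thesis
    by (simp add: nn_integral_N)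
qed

section \<open>Lower bounds for the eigenvalue\<close>

lemma prim_ennreal:
  assumes h: "continuous_on UNIV h" "\<And>t. 0 \<le> h t" and x: "0 \<le> x" "ereal x \<le> D"
  shows "prim (\<lambda>s. ennreal (h s)) x = ennreal (LBINT t=0..x. p t * h t)"
proof -
  have [measurable]: "h \<in> borel_measurable borel"
    using h(1) by (rule borel_measurable_continuous_onI)
  have "prim (\<lambda>s. ennreal (h s)) x = (\<integral>\<^sup>+t\<in>{0<..<x}. ennreal (p t * h t) \<partial>lborel)"
    using x(2) h(2) p_pos by (simp add: prim_lborel ennreal_mult less_imp_le mult.commute)
  also have "\<dots> = ennreal (LBINT t=0..x. p t * h t)"
    using h p_pos x(1)
    by (intro nn_integral_eq_LBINT_from_0 continuous_on_mult p_cont mult_nonneg_nonneg less_imp_le[OF p_pos]) auto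
  finally show ?thesis .
qed

text \<open>
  An admissible function satisfies \<open>|f| \<le> P |r|\<close> with \<open>r = f' / p\<close>, because \<open>f(0) = 0\<close>. So the Hardy
  inequality bounds \<open>\<mu>(f\<^sup>2)\<close> by \<open>K D(f)\<close>. The same estimate shows \<open>D(f) > 0\<close>, which excludes the
  quotient \<open>0 / 0 = 0\<close>.
\<close>

theorem inverse_le_lambda0:
  fixes g :: "real \<Rightarrow> ennreal" and K :: ennreal
  assumes [measurable]: "g \<in> borel_measurable borel"
    and g: "\<And>x. x \<in> I \<Longrightarrow> 0 < g x \<and> g x < top"
    and K: "\<And>x. x \<in> I \<Longrightarrow> prim (tail g) x \<le> K * g x"
  shows "inverse K \<le> lambda0 a b D"
proof (cases "K = top")
  case False
  then have K_fin: "K < top" by (simp add: less_top)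
  have "inverse K \<le> energy a b D f / mu_sq a b D f"
    if C1: "f C1_differentiable_on I" and cont: "continuous_on (cinterval D) f"
      and fin: "energy a b D f < \<infinity>" and f0: "f 0 = 0" and y: "y \<in> cinterval D" "f y \<noteq> 0" for f y
  proof -
    obtain f' where f': "\<And>x. x \<in> I \<Longrightarrow> (f has_real_derivative f' x) (at x)" "continuous_on I f'"
      using C1 unfolding C1_differentiable_on_def has_real_derivative_iff_has_vector_derivative by blast
    define r where "r s = indicator I s * f' s / p s" for s
    have "(\<lambda>s. indicator I s *\<^sub>R f' s) \<in> borel_measurable borel"
      using f'(2) by (intro borel_measurable_continuous_on_indicator) auto
    then have [measurable]: "r \<in> borel_measurable borel"
      unfolding r_def by simp
    have en: "energy a b D f = (\<integral>\<^sup>+s. (ennreal \<bar>r s\<bar>)\<^sup>2 \<partial>N)"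
    proof (subst energy_eq[where r=r and z=0])
      show "(f has_real_derivative p x * r x) (at x)" if "x \<in> I" for x
        using f'(1)[OF that] p_pos[of x] that by (simp add: r_def)
    qed (simp_all add: ennreal_power)
    have abs_le: "ennreal \<bar>f x\<bar> \<le> prim (\<lambda>s. ennreal \<bar>r s\<bar>) x" if x: "0 < x" "ereal x \<le> D" for x
    proof -
      have sub: "{0..x} \<subseteq> cinterval D" "{0<..<x} \<subseteq> I"
        using order_trans[OF _ x(2)] less_le_trans[OF _ x(2)] by (auto simp: cinterval_def einterval_iff)
      have "ennreal \<bar>f x - f 0\<bar> \<le> (\<integral>\<^sup>+t\<in>{0<..<x}. ennreal \<bar>f' t\<bar> \<partial>lborel)"
        using x(1) continuous_on_subset[OF cont sub(1)]
      proof (rule abs_diff_le_nn_integral_deriv)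
        show "continuous_on {0<..<x} f'"
          using f'(2) sub(2) by (rule continuous_on_subset)
      qed (use f'(1) sub(2) in blast)
      also have "\<dots> = prim (\<lambda>s. ennreal \<bar>r s\<bar>) x"
      proof -
        have "ennreal \<bar>f' t\<bar> * indicator {0<..<x} t = ennreal \<bar>r t\<bar> * ennreal (p t) * indicator {0<..<x} t" for t
        proof (cases "t \<in> {0<..<x}")
          case True
          with sub(2) have "t \<in> I" by blast
          then have "\<bar>f' t\<bar> = \<bar>r t\<bar> * p t"
            using p_pos[of t] by (simp add: r_def abs_mult)
          then show ?thesis
            using p_pos[of t] by (simp add: ennreal_mult)
        qed simp
        then show ?thesis
          using x(2) by (simp add: prim_lborel)
      qed
      finally show ?thesis using f0 by simp
    qed
    have "mu_sq a b D f \<le> (\<integral>\<^sup>+x. (prim (\<lambda>s. ennreal \<bar>r s\<bar>) x)\<^sup>2 \<partial>mu a b D)"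
      unfolding mu_sq_eq
    proof (intro nn_integral_mono_AE eventually_mono[OF M_concentrated])
      fix x assume "x \<in> I"
      then have "(ennreal \<bar>f x\<bar>)\<^sup>2 \<le> (prim (\<lambda>s. ennreal \<bar>r s\<bar>) x)\<^sup>2"
        by (intro power_mono abs_le) (auto simp: D_gt_0 le_D)
      then show "ennreal ((f x)\<^sup>2) \<le> (prim (\<lambda>s. ennreal \<bar>r s\<bar>) x)\<^sup>2"
        by (simp add: ennreal_power)
    qed
    also have "\<dots> \<le> K * energy a b D f"
      unfolding en by (rule Hardy_if_prim_tail_le[OF assms(1) _ g K_fin K]) measurable
    finally have le: "mu_sq a b D f \<le> K * energy a b D f" .
    \<comment> \<open>A function of energy zero would be zero, also at \<open>y = D\<close>.\<close>
    have "energy a b D f \<noteq> 0"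
    proof
      assume "energy a b D f = 0"
      then have "AE s in N. (ennreal \<bar>r s\<bar>)\<^sup>2 = 0"
        unfolding en by (subst (asm) nn_integral_0_iff_AE) auto
      then have "prim (\<lambda>s. ennreal \<bar>r s\<bar>) y = 0"
        unfolding prim_def by (subst nn_integral_0_iff_AE) (auto elim!: eventually_mono)
      moreover have "0 < y" "ereal y \<le> D"
        using y f0 by (auto simp: cinterval_def less_le)
      ultimately show False
        using abs_le[of y] y(2) by simp
    qed
    with le fin show ?thesis
      by (intro ennreal_inverse_le_divideI) (auto simp: zero_less_iff_neq_zero)
  qed
  then show ?thesis
    unfolding lambda0_def by (intro Inf_greatest) blast
qed simp

section \<open>Upper bounds for the eigenvalue by stopped functions\<close>

text \<open>
  A function stopped at \<open>x\<^sub>0\<close> is described by its continuous derivative \<open>H\<close> with respect to \<open>\<nu>\<close> on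
  \<open>(0,x\<^sub>0)\<close>.
\<close>

context
  fixes x0 :: real and H F :: "real \<Rightarrow> real"
  assumes x0: "x0 \<in> I"
    and H: "continuous_on UNIV H" "\<And>s. 0 \<le> H s" "\<And>s. s \<in> I \<Longrightarrow> 0 < H s"
    and F: "\<And>x. x \<in> I \<Longrightarrow> ennreal (F x) = prim (\<lambda>s. ennreal (H s)) (min x x0)"
    and F_nonneg: "\<And>x. x \<in> I \<Longrightarrow> 0 \<le> F x"
begin

lemma stopped_eq_LBINT: "x \<in> I \<Longrightarrow> F x = (LBINT t=0..min x x0. p t * H t)"
proof -
  assume x: "x \<in> I"
  have mI: "0 \<le> min x x0" "ereal (min x x0) \<le> D"
    using min_in_I[OF x x0] D_gt_0 le_D less_imp_le by blast+
  have "0 \<le> (LBINT t=0..ereal y. p t * H t)" if "0 \<le> y" for y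
    unfolding interval_lebesgue_integral_def set_lebesgue_integral_def
    using that H(2) less_imp_le[OF p_pos] by (simp add: zero_ereal_def)
  note nn = this[OF mI(1)]
  show ?thesis
    using F[OF x] prim_ennreal[OF H(1,2) mI] F_nonneg[OF x] nn by simp
qed

lemma energy_stopped: "energy a b D F = prim (\<lambda>s. ennreal ((H s)\<^sup>2)) x0"
proof -
  have [measurable]: "H \<in> borel_measurable borel"
    using H(1) by (rule borel_measurable_continuous_onI)
  have deriv: "((\<lambda>x. LBINT t=0..x. p t * H t) has_real_derivative p x * H x) (at x)" for x
    by (rule has_real_derivative_LBINT_from_0) (intro continuous_intros p_cont H)
  have "energy a b D F = (\<integral>\<^sup>+s. ennreal ((H s * indicator {..<x0} s)\<^sup>2) \<partial>N)"
  proof (rule energy_eq[where z=x0])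
    fix x assume x: "x \<in> I" "x \<noteq> x0"
    show "(F has_real_derivative p x * (H x * indicator {..<x0} x)) (at x)"
    proof (cases "x < x0")
      case True
      have "(F has_real_derivative p x * H x) (at x)"
      proof (rule has_field_derivative_transform_within_open[OF deriv])
        show "open (I \<inter> {..<x0})" "x \<in> I \<inter> {..<x0}"
          using x True by (auto intro!: open_Int)
      qed (auto simp: stopped_eq_LBINT min_def)
      then show ?thesis using True by simp
    next
      case False
      have "(F has_real_derivative 0) (at x)"
      proof (rule has_field_derivative_transform_within_open[OF DERIV_const])
        show "open (I \<inter> {x0<..})" "x \<in> I \<inter> {x0<..}"
          using x False by (auto intro!: open_Int)
      qed (auto simp: stopped_eq_LBINT min_def)
      then show ?thesis using False by simp
    qed
  qed measurable
  also have "\<dots> = prim (\<lambda>s. ennreal ((H s)\<^sup>2)) x0"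
    unfolding prim_def
    by (intro nn_integral_cong_AE eventually_mono[OF N_concentrated]) (simp add: indicator_def D_gt_0)
  finally show ?thesis .
qed

lemma energy_stopped_finite: "energy a b D F < top"
  unfolding energy_stopped
  using x0 by (subst prim_ennreal) (auto intro!: continuous_intros H less_imp_le D_gt_0 le_D)

lemma energy_stopped_pos: "0 < energy a b D F"
proof -
  have [measurable]: "H \<in> borel_measurable borel"
    using H(1) by (rule borel_measurable_continuous_onI)
  show ?thesis
    unfolding energy_stopped
  proof (rule prim_pos[OF _ x0])
    fix s assume "s \<in> I"
    then show "0 < ennreal ((H s)\<^sup>2)"
      using H(3)[of s] by (simp add: ennreal_less_zero_iff)
  qed measurable
qed

text \<open>
  The function is made continuously differentiable by continuing its derivative past \<open>x\<^sub>0\<close> with a linear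
  cutoff of width \<open>\<eta>\<close>. This increases the function, so \<open>\<mu>(F\<^sup>2)\<close> does not decrease, and it costs an
  energy of at most \<open>B \<eta>\<close>, where \<open>B\<close> bounds \<open>p H\<^sup>2\<close> to the right of \<open>x\<^sub>0\<close>.
\<close>

lemma lambda0_mult_mu_sq_stopped_le: "lambda0 a b D * mu_sq a b D F \<le> energy a b D F"
proof -
  have [measurable]: "H \<in> borel_measurable borel"
    using H(1) by (rule borel_measurable_continuous_onI)
  obtain y0 where y0: "x0 < y0" "ereal y0 < D"
    using ereal_dense2[OF less_D[OF x0]] by auto
  have "\<exists>t\<in>{x0..y0}. \<forall>s\<in>{x0..y0}. p s * (H s)\<^sup>2 \<le> p t * (H t)\<^sup>2"
    using y0(1) H(1) by (intro continuous_attains_sup continuous_intros continuous_on_subset[OF p_cont])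
      (auto intro: continuous_on_subset)
  then obtain B where B: "\<And>s. s \<in> {x0..y0} \<Longrightarrow> p s * (H s)\<^sup>2 \<le> B" by blast
  have "0 \<le> p x0 * (H x0)\<^sup>2" using p_pos[of x0] by simp
  with B[of x0] y0(1) have B0: "0 \<le> B" by simp
  show ?thesis
  proof (rule ennreal_le_epsilon)
    fix e :: real assume "0 < e"
    \<comment> \<open>The denominator is \<open>B + 1\<close> because \<open>B\<close> may be zero.\<close>
    define \<eta> where "\<eta> = min (y0 - x0) (e / (B + 1))"
    have eta: "0 < \<eta>" "x0 + \<eta> \<le> y0"
      using y0(1) \<open>0 < e\<close> B0 by (auto simp: \<eta>_def)
    have "B * \<eta> \<le> (B + 1) * (e / (B + 1))"
      using B0 \<open>0 < e\<close> eta(1) by (intro mult_mono) (auto simp: \<eta>_def)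
    then have B_eta: "B * \<eta> \<le> e" using B0 by simp
    define cut where "cut x = max 0 (min 1 (1 - (x - x0) / \<eta>))" for x
    have chi: "\<And>x. 0 \<le> cut x" "\<And>x. cut x \<le> 1" "\<And>x. x \<le> x0 \<Longrightarrow> cut x = 1" "\<And>x. x0 + \<eta> \<le> x \<Longrightarrow> cut x = 0"
      using eta(1) by (auto simp: cut_def min_def field_simps)
    have chi_cont: "continuous_on UNIV cut"
      unfolding cut_def[abs_def] using eta(1) by (intro continuous_intros) auto
    define h where "h t = H t * cut t" for t
    have h: "continuous_on UNIV h" "\<And>t. 0 \<le> h t"
      unfolding h_def using chi(1) H(2) by (auto intro!: continuous_intros H chi_cont)
    have [measurable]: "h \<in> borel_measurable borel"
      using h(1) by (rule borel_measurable_continuous_onI)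
    define f where "f x = (LBINT t=0..ereal x. p t * h t)" for x
    have prim_h: "prim (\<lambda>s. ennreal (h s)) x = ennreal (f x)" if "0 \<le> x" "ereal x \<le> D" for x
      unfolding f_def using h that by (rule prim_ennreal)
    have deriv: "(f has_real_derivative p x * h x) (at x)" for x
      unfolding f_def[abs_def] by (rule has_real_derivative_LBINT_from_0) (intro continuous_intros p_cont h)
    have C1: "f C1_differentiable_on I"
      unfolding C1_differentiable_on_def has_real_derivative_iff_has_vector_derivative[symmetric]
      by (rule exI[of _ "\<lambda>x. p x * h x"])
         (auto intro!: deriv continuous_intros continuous_on_subset[OF p_cont] continuous_on_subset[OF h(1)])
    have cont: "continuous_on (cinterval D) f"
      using deriv by (intro DERIV_continuous_on) (auto intro: has_field_derivative_at_within)
    have f0: "f 0 = 0"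
      by (simp add: f_def zero_ereal_def[symmetric])
    have "0 < prim (\<lambda>s. ennreal (h s)) x0"
    proof (rule prim_pos[OF _ x0])
      show "0 < ennreal (h s)" if "s \<in> I" "s < x0" for s
        using H(3)[OF that(1)] that(2) by (simp add: h_def chi(3))
    qed measurable
    then have f_x0: "f x0 \<noteq> 0"
      using x0 by (simp add: prim_h D_gt_0 le_D less_imp_le)
    have "energy a b D f = (\<integral>\<^sup>+s. ennreal ((h s)\<^sup>2) \<partial>N)"
      by (rule energy_eq[where z=0]) (use deriv in auto)
    also have "\<dots> \<le> (\<integral>\<^sup>+s. ennreal ((H s)\<^sup>2) * indicator {0<..<x0} s + ennreal ((H s)\<^sup>2) * indicator {x0..x0+\<eta>} s \<partial>N)"
    proof (intro nn_integral_mono_AE eventually_mono[OF N_concentrated])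
      fix s assume s: "s \<in> I"
      have "(h s)\<^sup>2 \<le> (H s)\<^sup>2"
        using chi(1,2)[of s] H(2)[of s] h(2)[of s]
        by (intro power_mono) (auto simp: h_def intro: mult_left_le)
      then show "ennreal ((h s)\<^sup>2) \<le> ennreal ((H s)\<^sup>2) * indicator {0<..<x0} s + ennreal ((H s)\<^sup>2) * indicator {x0..x0+\<eta>} s"
        using D_gt_0[OF s] chi(4)[of s]
        by (cases "s < x0"; cases "s \<le> x0 + \<eta>") (auto simp: h_def intro!: ennreal_leI)
    qed
    also have "\<dots> = energy a b D F + (\<integral>\<^sup>+s. ennreal ((H s)\<^sup>2) * indicator {x0..x0+\<eta>} s \<partial>N)"
      by (subst nn_integral_add) (auto simp: energy_stopped prim_def)
    also have "(\<integral>\<^sup>+s. ennreal ((H s)\<^sup>2) * indicator {x0..x0+\<eta>} s \<partial>N) \<le> (\<integral>\<^sup>+s. ennreal B * indicator {x0..x0+\<eta>} s \<partial>lborel)"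
    proof (subst nn_integral_N, measurable, intro nn_integral_mono)
      fix s
      show "ennreal ((H s)\<^sup>2) * indicator {x0..x0+\<eta>} s * ennreal (p s) * indicator I s \<le> ennreal B * indicator {x0..x0+\<eta>} s"
      proof (cases "s \<in> {x0..x0+\<eta>}")
        case True
        then have "(H s)\<^sup>2 * p s \<le> B"
          using B[of s] eta(2) by (simp add: mult.commute)
        then have "ennreal ((H s)\<^sup>2) * ennreal (p s) \<le> ennreal B"
          using p_pos[of s] by (simp add: ennreal_mult[symmetric] ennreal_leI)
        then show ?thesis
          using True by (simp add: indicator_def)
      qed simp
    qed
    also have "\<dots> = ennreal (B * \<eta>)"
      using eta(1) B0 by (simp add: nn_integral_cmult ennreal_mult)
    also have "ennreal (B * \<eta>) \<le> ennreal e"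
      using B_eta by (rule ennreal_leI)
    finally have energy_f: "energy a b D f \<le> energy a b D F + ennreal e"
      by (simp add: add_left_mono)
    then have fin: "energy a b D f < \<infinity>"
      using energy_stopped_finite by (auto simp: less_top[symmetric] top_unique)
    have "mu_sq a b D F \<le> mu_sq a b D f"
      unfolding mu_sq_eq
    proof (intro nn_integral_mono_AE eventually_mono[OF M_concentrated])
      fix x assume x: "x \<in> I"
      have "ennreal (F x) = prim (\<lambda>s. ennreal (h s)) (min x x0)"
        unfolding F[OF x] prim_def
        by (intro nn_integral_cong) (simp add: indicator_def h_def chi(3))
      also have "\<dots> \<le> prim (\<lambda>s. ennreal (h s)) x"
        by (rule prim_mono_right) simp
      also have "\<dots> = ennreal (f x)"
        using x by (intro prim_h) (auto intro: less_imp_le D_gt_0 le_D)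
      finally have "ennreal (F x) \<le> ennreal (f x)" .
      then have "(F x)\<^sup>2 \<le> (f x)\<^sup>2"
        using F_nonneg[OF x] by (cases "0 \<le> f x") (auto simp: ennreal_neg intro!: power_mono)
      then show "ennreal ((F x)\<^sup>2) \<le> ennreal ((f x)\<^sup>2)"
        by (rule ennreal_leI)
    qed
    moreover have "lambda0 a b D \<le> energy a b D f / mu_sq a b D f"
      unfolding lambda0_def
    proof (rule Inf_lower, rule CollectI, rule exI[of _ f], intro conjI refl C1 cont fin f0)
      show "\<exists>x\<in>cinterval D. f x \<noteq> 0"
        using f_x0 x0 by (intro bexI[of _ x0]) (auto simp: cinterval_def D_gt_0 le_D less_imp_le)
    qed
    ultimately have "lambda0 a b D * mu_sq a b D F \<le> energy a b D f / mu_sq a b D f * mu_sq a b D f"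
      by (intro mult_mono) auto
    also have "\<dots> \<le> energy a b D f"
      by (rule ennreal_divide_mult_le)
    finally show "lambda0 a b D * mu_sq a b D F \<le> energy a b D F + ennreal e"
      using energy_f by (rule order_trans)
  qed
qed

end

section \<open>The iteration started at the square root of the scale function\<close>

text \<open>
  Finiteness and positivity of \<open>f\<close> at the point in question allow clearing the denominator of \<open>II(f)\<close>.
\<close>

lemma II_le_iff:
  assumes "0 < f x" "f x < top"
  shows "II a b D f x \<le> K \<longleftrightarrow> prim (tail f) x \<le> K * f x"
proof
  assume "II a b D f x \<le> K"
  then have "f x * (prim (tail f) x / f x) \<le> f x * K"
    unfolding II_eq by (rule mult_left_mono) simp
  then show "prim (tail f) x \<le> K * f x"
    using assms by (simp add: ennreal_mult_divide_cancel mult.commute)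
next
  assume "prim (tail f) x \<le> K * f x"
  then show "II a b D f x \<le> K"
    unfolding II_eq using assms by (intro divide_le_posI_ennreal) (simp_all add: mult.commute)
qed

lemma le_II_iff:
  assumes "0 < f x" "f x < top"
  shows "K \<le> II a b D f x \<longleftrightarrow> K * f x \<le> prim (tail f) x"
proof
  assume "K \<le> II a b D f x"
  then have "f x * K \<le> f x * (prim (tail f) x / f x)"
    unfolding II_eq by (rule mult_left_mono) simp
  then show "K * f x \<le> prim (tail f) x"
    using assms by (simp add: ennreal_mult_divide_cancel mult.commute)
next
  assume "K * f x \<le> prim (tail f) x"
  then show "K \<le> II a b D f x"
    unfolding II_eq using assms by (intro ennreal_le_divideI)
qed

lemma mult_II:
  assumes "0 < f x" "f x < top"
  shows "f x * II a b D f x = prim (tail f) x"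
  unfolding II_eq using assms by (rule ennreal_mult_divide_cancel)

lemma II_measurable [measurable]:
  assumes [measurable]: "f \<in> borel_measurable borel"
  shows "II a b D f \<in> borel_measurable borel"
  unfolding II_eq[abs_def] by measurable

lemma phi_measurable [measurable]: "phi a b D \<in> borel_measurable borel"
  unfolding phi_eq[abs_def] by measurable

lemma f_seq_Suc:
  "1 \<le> n \<Longrightarrow> f_seq a b D (Suc n) = (\<lambda>x. f_seq a b D n x * II a b D (f_seq a b D n) x)"
  by (cases n) (simp_all add: f_seq_def)

lemma f_seq_measurable [measurable]: "f_seq a b D n \<in> borel_measurable borel"
proof (induction n)
  case (Suc n)
  note [measurable] = Suc.IH
  show ?case
  proof (cases "n = 0")
    case False
    then have "1 \<le> n" by simp
    then show ?thesis by (subst f_seq_Suc) measurable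
  qed (simp add: f_seq_def)
qed (simp add: f_seq_def)

lemma f_seq_1: "x \<in> I \<Longrightarrow> f_seq a b D 1 x = ennreal (sqrt (\<Phi> x))"
  using Phi_pos[OF D_gt_0] by (simp add: f_seq_def phi_eq prim_1 less_imp_le)

text \<open>
  All three assertions go into one induction: \<open>f\<^sub>n\<^sub>+\<^sub>1\<close> is finite because it is at most \<open>\<delta>\<^sub>n f\<^sub>n\<close> and
  \<open>\<delta>\<^sub>n \<le> 4\<delta>\<close> is finite, and only for finite \<open>f\<^sub>n\<^sub>+\<^sub>1\<close> can \<open>\<delta>\<^sub>n\<^sub>+\<^sub>1\<close> be compared with \<open>\<delta>\<^sub>n\<close>.
\<close>

lemma f_seq_bounds:
  assumes delta: "delta a b D < top" and n: "1 \<le> n"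
  shows "(\<forall>x\<in>I. 0 < f_seq a b D n x \<and> f_seq a b D n x < top) \<and> delta_seq a b D n \<le> 4 * delta a b D
    \<and> delta_seq a b D (Suc n) \<le> delta_seq a b D n"
  using n
proof (induction n rule: dec_induct)
  have next_le: "(\<forall>x\<in>I. 0 < f_seq a b D (Suc n) x \<and> f_seq a b D (Suc n) x < top)
      \<and> delta_seq a b D (Suc n) \<le> delta_seq a b D n"
    if "1 \<le> n" and f: "\<And>x. x \<in> I \<Longrightarrow> 0 < f_seq a b D n x \<and> f_seq a b D n x < top"
      and K: "delta_seq a b D n \<le> 4 * delta a b D" for n
  proof -
    let ?f = "f_seq a b D n" and ?g = "f_seq a b D (Suc n)" and ?K = "delta_seq a b D n"
    have K_fin: "?K < top"
      using K delta by (metis ennreal_mult_less_top ennreal_numeral_less_top order_le_less_trans)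
    have g: "?g x = prim (tail ?f) x" if "x \<in> I" for x
      using f[OF that] \<open>1 \<le> n\<close> by (simp add: f_seq_Suc mult_II)
    have g_le: "?g x \<le> ?K * ?f x" if "x \<in> I" for x
    proof -
      have "II a b D ?f x \<le> ?K"
        unfolding delta_seq_def using that by (rule SUP_upper)
      then show ?thesis
        using f[OF that] by (simp add: II_le_iff g[OF that])
    qed
    have g_bounds: "0 < ?g x" "?g x < top" if "x \<in> I" for x
    proof -
      show "0 < ?g x"
        unfolding g[OF that] using that f by (intro prim_pos tail_pos) auto
      show "?g x < top"
        using g_le[OF that] f[OF that] K_fin by (metis ennreal_mult_less_top order_le_less_trans)
    qed
    have "prim (tail ?g) x \<le> ?K * ?g x" if "x \<in> I" for x
    proof -
      have "prim (tail ?g) x \<le> prim (\<lambda>s. ?K * tail ?f s) x"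
        by (intro prim_mono) (simp add: tail_cmult[symmetric] tail_mono g_le)
      also have "\<dots> = ?K * ?g x"
        using that by (simp add: prim_cmult g)
      finally show ?thesis .
    qed
    then have "delta_seq a b D (Suc n) \<le> ?K"
      unfolding delta_seq_def[of _ _ _ "Suc n"] using g_bounds by (intro SUP_least) (simp add: II_le_iff)
    with g_bounds show ?thesis by blast
  qed
  {
    case base
    have f: "0 < f_seq a b D 1 x \<and> f_seq a b D 1 x < top" if "x \<in> I" for x
      unfolding f_seq_1[OF that] using that by (simp add: Phi_pos D_gt_0)
    have le: "ennreal (\<Phi> x) * emeasure (mu a b D) (einterval (ereal x) D) \<le> delta a b D" if "x \<in> I" for x
    proof -
      have "phi a b D x * emeasure (mu a b D) (einterval (ereal x) D) \<le> delta a b D"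
        unfolding delta_def phi_def using that by (rule SUP_upper)
      then show ?thesis using that by (simp add: phi_eq prim_1)
    qed
    have "prim (tail (f_seq a b D 1)) x \<le> 4 * delta a b D * f_seq a b D 1 x" if "x \<in> I" for x
    proof -
      have "prim (tail (f_seq a b D 1)) x \<le> prim (tail (\<lambda>u. ennreal (sqrt (\<Phi> u)))) x"
        by (intro prim_mono tail_mono) (simp add: f_seq_1[unfolded One_nat_def])
      also have "\<dots> \<le> 4 * delta a b D * f_seq a b D 1 x"
        unfolding f_seq_1[OF that] using le that by (rule prim_tail_sqrt_Phi_le)
      finally show ?thesis .
    qed
    then have "delta_seq a b D 1 \<le> 4 * delta a b D"
      unfolding delta_seq_def using f by (intro SUP_least) (simp add: II_le_iff)
    then show ?case using f next_le[of 1] by blast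
  next
    case (step n)
    then show ?case
      using next_le[of n] next_le[of "Suc n"] by (meson le_SucI order_trans)
  }
qed

section \<open>The iteration with stopped functions\<close>

lemma f_stop_Suc:
  "1 \<le> n \<Longrightarrow> f_stop a b D x0 (Suc n)
    = (\<lambda>x. f_stop a b D x0 n (min x x0) * II a b D (f_stop a b D x0 n) (min x x0))"
  by (cases n) (simp_all add: f_stop_def)

lemma f_stop_1: "f_stop a b D x0 1 x = prim (\<lambda>_. 1) (min x x0)"
  by (simp add: f_stop_def phi_eq)

lemma f_stop_measurable [measurable]: "f_stop a b D x0 n \<in> borel_measurable borel"
proof (induction n)
  case (Suc n)
  note [measurable] = Suc.IH
  show ?case
  proof (cases "n = 0")
    case False
    then have "1 \<le> n" by simp
    then show ?thesis by (subst f_stop_Suc) measurable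
  qed (simp add: f_stop_def)
qed (simp add: f_stop_def)

text \<open>
  The derivative with respect to \<open>\<nu>\<close> of the \<open>n\<close>-th function on \<open>(0,x\<^sub>0)\<close>: it is \<open>1\<close> for \<open>\<phi>\<close> and
  \<open>T f\<^sub>n\<close> for \<open>f\<^sub>n\<^sub>+\<^sub>1\<close>.
\<close>

definition stop_density :: "real \<Rightarrow> nat \<Rightarrow> real \<Rightarrow> real" where
  "stop_density x0 n s = (if n \<le> 1 then 1 else enn2real (tail (f_stop a b D x0 (n - 1)) s))"

context
  fixes x0 :: real
  assumes x0: "x0 \<in> I"
begin

abbreviation "F \<equiv> f_stop a b D x0"
abbreviation "H \<equiv> stop_density x0"

text \<open>
  A stopped function is bounded by its value at \<open>x\<^sub>0\<close>, so that the finiteness of \<open>\<mu>\<close> makes it integrable.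
\<close>

lemma f_stop_finite_if:
  assumes H: "continuous_on UNIV (H n)" "\<And>s. 0 \<le> H n s" "\<And>s. s \<in> I \<Longrightarrow> 0 < H n s"
    and F: "\<And>x. x \<in> I \<Longrightarrow> F n x = prim (\<lambda>s. ennreal (H n s)) (min x x0)"
  shows "\<And>x. x \<in> I \<Longrightarrow> 0 < F n x" "\<And>x. x \<in> I \<Longrightarrow> F n x < top" "(\<integral>\<^sup>+u. F n u \<partial>mu a b D) < top"
proof -
  have [measurable]: "H n \<in> borel_measurable borel"
    using H(1) by (rule borel_measurable_continuous_onI)
  let ?B = "prim (\<lambda>s. ennreal (H n s)) x0"
  have B: "?B < top"
    using x0 H by (subst prim_ennreal) (auto intro: less_imp_le D_gt_0 le_D)
  have le: "F n x \<le> ?B" if "x \<in> I" for x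
    unfolding F[OF that] by (rule prim_mono_right) simp
  show "F n x < top" if "x \<in> I" for x
    using le[OF that] B by (rule order_le_less_trans)
  show "0 < F n x" if "x \<in> I" for x
    unfolding F[OF that] using H(3) by (intro prim_pos min_in_I that x0) simp_all
  have "(\<integral>\<^sup>+u. F n u \<partial>mu a b D) \<le> (\<integral>\<^sup>+u. ?B \<partial>mu a b D)"
    by (intro nn_integral_mono_AE eventually_mono[OF M_concentrated] le)
  also have "\<dots> < top"
    using B M_finite by (simp add: ennreal_mult_less_top)
  finally show "(\<integral>\<^sup>+u. F n u \<partial>mu a b D) < top" .
qed

text \<open>
  By induction, the integrability of \<open>f\<^sub>n\<close> makes its tail finite and continuous, and the tail is the
  density of \<open>f\<^sub>n\<^sub>+\<^sub>1\<close>.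
\<close>

lemma f_stop_density:
  assumes "1 \<le> n"
  shows "continuous_on UNIV (H n) \<and> (\<forall>s. 0 \<le> H n s) \<and> (\<forall>s\<in>I. 0 < H n s)
    \<and> (\<forall>x\<in>I. F n x = prim (\<lambda>s. ennreal (H n s)) (min x x0))"
  using assms
proof (induction n rule: dec_induct)
  case base
  then show ?case
    by (simp add: stop_density_def f_stop_1[unfolded One_nat_def])
next
  case (step n)
  have fin: "\<And>x. x \<in> I \<Longrightarrow> 0 < F n x" "\<And>x. x \<in> I \<Longrightarrow> F n x < top" "(\<integral>\<^sup>+u. F n u \<partial>mu a b D) < top"
    using f_stop_finite_if[of n] step.IH by blast+
  have tail_fin: "tail (F n) s < top" for s
    using fin(3) by (rule tail_finite)
  have H_eq: "H (Suc n) = (\<lambda>s. enn2real (tail (F n) s))"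
    using step.hyps by (simp add: stop_density_def fun_eq_iff)
  have H_tail: "ennreal (H (Suc n) s) = tail (F n) s" for s
    unfolding H_eq using tail_fin[of s] by simp
  have "continuous_on UNIV (H (Suc n))"
  proof -
    have "isCont (tail (F n)) s" for s
      using continuous_on_tail[OF f_stop_measurable fin(3)] by (simp add: continuous_on_eq_continuous_at)
    then have "isCont (H (Suc n)) s" for s
      unfolding H_eq isCont_def using tail_fin[of s]
      by (intro tendsto_enn2real) simp_all
    then show ?thesis by (simp add: continuous_at_imp_continuous_on)
  qed
  moreover have "0 < H (Suc n) s" if "s \<in> I" for s
    using tail_pos[OF f_stop_measurable that, of x0 n] fin(1) H_tail[of s]
    by (metis ennreal_less_zero_iff)
  moreover have "F (Suc n) x = prim (\<lambda>s. ennreal (H (Suc n) s)) (min x x0)" if "x \<in> I" for x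
    unfolding H_tail using step.hyps fin(1,2)[OF min_in_I[OF that x0]] by (simp add: f_stop_Suc mult_II)
  ultimately show ?case by (simp add: H_eq)
qed

lemmas stop_density_continuous = f_stop_density[THEN conjunct1]
lemmas stop_density_nonneg = f_stop_density[THEN conjunct2, THEN conjunct1, rule_format]
lemmas stop_density_pos = f_stop_density[THEN conjunct2, THEN conjunct2, THEN conjunct1, rule_format]
lemmas f_stop_eq_prim = f_stop_density[THEN conjunct2, THEN conjunct2, THEN conjunct2, rule_format]

lemma f_stop_bounds:
  assumes "1 \<le> n"
  shows "\<And>x. x \<in> I \<Longrightarrow> 0 < F n x" "\<And>x. x \<in> I \<Longrightarrow> F n x < top" "(\<integral>\<^sup>+u. F n u \<partial>mu a b D) < top"
  using f_stop_finite_if[of n] f_stop_density[OF assms] by blast+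

lemma stop_density_Suc: "1 \<le> n \<Longrightarrow> ennreal (H (Suc n) s) = tail (F n) s"
  using tail_finite[OF f_stop_bounds(3), of n s] by (simp add: stop_density_def)

lemma f_stop_min: "1 \<le> n \<Longrightarrow> x \<in> I \<Longrightarrow> F n (min x x0) = F n x"
  by (simp add: f_stop_eq_prim min_in_I x0)

lemma f_stop_Suc_eq:
  "1 \<le> n \<Longrightarrow> x \<in> I \<Longrightarrow> F (Suc n) x = prim (tail (F n)) (min x x0)"
  by (simp add: f_stop_eq_prim stop_density_Suc)

lemma mult_f_stop_le:
  assumes n: "1 \<le> n" and x: "x \<in> I"
  shows "(INF x\<in>I. II a b D (F n) x) * F n x \<le> F (Suc n) x"
proof -
  let ?m = "min x x0"
  have m: "?m \<in> I" using x x0 by (rule min_in_I)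
  have "(INF x\<in>I. II a b D (F n) x) \<le> II a b D (F n) ?m"
    using m by (rule INF_lower)
  then have "(INF x\<in>I. II a b D (F n) x) * F n ?m \<le> prim (tail (F n)) ?m"
    using f_stop_bounds[OF n] m by (simp add: le_II_iff)
  then show ?thesis
    by (simp only: f_stop_min[OF n x] f_stop_Suc_eq[OF n x])
qed

text \<open>
  From \<open>f\<^sub>n\<^sub>+\<^sub>1 \<ge> c f\<^sub>n\<close> one gets \<open>P(T f\<^sub>n\<^sub>+\<^sub>1)(x) \<ge> c P(T f\<^sub>n)(x)\<close>. The right-hand side is at least
  \<open>c f\<^sub>n\<^sub>+\<^sub>1(x)\<close>, because stopping at \<open>x\<^sub>0\<close> can only decrease \<open>P(T f\<^sub>n)\<close>.
\<close>

lemma INF_II_f_stop_mono: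
  assumes n: "1 \<le> n"
  shows "(INF x\<in>I. II a b D (F n) x) \<le> (INF x\<in>I. II a b D (F (Suc n)) x)"
proof (rule INF_greatest)
  fix x assume x: "x \<in> I"
  let ?c = "INF x\<in>I. II a b D (F n) x"
  have "?c * F (Suc n) x = ?c * prim (tail (F n)) (min x x0)"
    using n x by (simp add: f_stop_Suc_eq)
  also have "\<dots> \<le> ?c * prim (tail (F n)) x"
    by (intro mult_left_mono prim_mono_right) simp_all
  also have "\<dots> = prim (\<lambda>s. tail (\<lambda>u. ?c * F n u) s) x"
    by (simp add: tail_cmult prim_cmult)
  also have "\<dots> \<le> prim (tail (F (Suc n))) x"
    using n by (intro prim_mono tail_mono mult_f_stop_le)
  finally show "?c \<le> II a b D (F (Suc n)) x"
    using f_stop_bounds[of "Suc n"] x by (simp add: le_II_iff)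
qed

text \<open>
  For \<open>s < x\<^sub>0\<close> the tail \<open>T f\<^sub>1(s)\<close> is at least \<open>T f\<^sub>1(x\<^sub>0) = \<phi>(x\<^sub>0) \<mu>(x\<^sub>0,D)\<close>, as \<open>f\<^sub>1\<close> is constant to the
  right of \<open>x\<^sub>0\<close>.
\<close>

lemma delta_le_INF_II_f_stop_1:
  "phi a b D x0 * emeasure (mu a b D) (einterval (ereal x0) D) \<le> (INF x\<in>I. II a b D (F 1) x)"
proof (rule INF_greatest)
  fix x assume x: "x \<in> I"
  let ?m = "min x x0" and ?M = "emeasure (mu a b D) (einterval (ereal x0) D)"
  have "F 1 u * indicator (einterval (ereal x0) D) u = phi a b D x0 * indicator (einterval (ereal x0) D) u" for u
    unfolding f_stop_1 phi_eq by (simp add: indicator_def einterval_iff min_def)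
  then have tail: "tail (F 1) x0 = phi a b D x0 * ?M"
    unfolding tail_def by (simp add: nn_integral_cmult)
  have "tail (F 1) x0 * prim (\<lambda>_. 1) ?m = prim (\<lambda>_. tail (F 1) x0 * 1) ?m"
    by (rule prim_cmult[symmetric]) simp
  also have "\<dots> \<le> prim (tail (F 1)) ?m"
    by (rule prim_mono) (simp add: tail_antimono)
  also have "\<dots> \<le> prim (tail (F 1)) x"
    by (rule prim_mono_right) simp
  finally have "phi a b D x0 * ?M * F 1 x \<le> prim (tail (F 1)) x"
    unfolding tail f_stop_1 .
  then show "phi a b D x0 * ?M \<le> II a b D (F 1) x"
    using f_stop_bounds(1,2)[OF order_refl x] by (subst le_II_iff)
qed

abbreviation "\<FF> n x \<equiv> enn2real (F n x)"

lemma enn2real_f_stop: "1 \<le> n \<Longrightarrow> x \<in> I \<Longrightarrow> ennreal (\<FF> n x) = F n x"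
  using f_stop_bounds(2)[of n x] by simp

lemma mu_sq_f_stop:
  assumes "1 \<le> n"
  shows "mu_sq a b D (\<FF> n) = (\<integral>\<^sup>+u. F n u * F n u \<partial>mu a b D)"
  unfolding mu_sq_eq
  by (intro nn_integral_cong_AE eventually_mono[OF M_concentrated])
     (simp add: enn2real_f_stop[OF assms] power2_eq_square ennreal_mult)

lemma f_stop_prim_ennreal:
  "1 \<le> n \<Longrightarrow> x \<in> I \<Longrightarrow> ennreal (\<FF> n x) = prim (\<lambda>s. ennreal (H n s)) (min x x0)"
  by (rule trans[OF enn2real_f_stop f_stop_eq_prim])

lemma energy_f_stop:
  assumes "1 \<le> n"
  shows "energy a b D (\<FF> n) = prim (\<lambda>s. ennreal ((H n s)\<^sup>2)) x0"
    and "energy a b D (\<FF> n) < top" "0 < energy a b D (\<FF> n)"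
    and "lambda0 a b D * mu_sq a b D (\<FF> n) \<le> energy a b D (\<FF> n)"
proof -
  note * = stop_density_continuous[OF assms] stop_density_nonneg[OF assms] stop_density_pos[OF assms]
    f_stop_prim_ennreal[OF assms] enn2real_nonneg
  show "energy a b D (\<FF> n) = prim (\<lambda>s. ennreal ((H n s)\<^sup>2)) x0"
    using x0 * by (rule energy_stopped)
  show "energy a b D (\<FF> n) < top"
    using x0 * by (rule energy_stopped_finite)
  show "0 < energy a b D (\<FF> n)"
    using x0 * by (rule energy_stopped_pos)
  show "lambda0 a b D * mu_sq a b D (\<FF> n) \<le> energy a b D (\<FF> n)"
    using x0 * by (rule lambda0_mult_mu_sq_stopped_le)
qed

lemma f_stop_ratio_le: "1 \<le> n \<Longrightarrow> mu_sq a b D (\<FF> n) / energy a b D (\<FF> n) \<le> inverse (lambda0 a b D)"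
  by (intro ennreal_divide_le_inverseI energy_f_stop)

text \<open>
  The energy is \<open>\<integral> (T f\<^sub>n)\<^sup>2 d\<nu>\<close> over \<open>(0,x\<^sub>0)\<close>; the adjointness moves one of the two factors \<open>T\<close> to the
  other one, where it becomes \<open>P(T f\<^sub>n) = f\<^sub>n\<^sub>+\<^sub>1\<close>.
\<close>

lemma energy_f_stop_Suc:
  assumes n: "1 \<le> n"
  shows "energy a b D (\<FF> (Suc n)) = (\<integral>\<^sup>+u. F n u * F (Suc n) u \<partial>mu a b D)"
proof -
  have "energy a b D (\<FF> (Suc n)) = prim (\<lambda>s. tail (F n) s * tail (F n) s) x0"
    using n by (simp add: energy_f_stop(1) ennreal_power[symmetric] stop_density_nonneg stop_density_Suc
        power2_eq_square ennreal_mult)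
  also have "\<dots> = (\<integral>\<^sup>+u. F n u * prim (tail (F n)) (min u x0) \<partial>mu a b D)"
    by (rule prim_mult_tail) measurable
  also have "\<dots> = (\<integral>\<^sup>+u. F n u * F (Suc n) u \<partial>mu a b D)"
    by (intro nn_integral_cong_AE eventually_mono[OF M_concentrated]) (simp only: f_stop_Suc_eq[OF n])
  finally show ?thesis .
qed

text \<open>
  Replace \<open>f\<^sub>n\<close> in \<open>c D(f\<^sub>n\<^sub>+\<^sub>1) = \<mu>(c f\<^sub>n f\<^sub>n\<^sub>+\<^sub>1)\<close> by means of \<open>c f\<^sub>n \<le> f\<^sub>n\<^sub>+\<^sub>1\<close>.
\<close>

lemma INF_II_f_stop_le_ratio:
  assumes n: "1 \<le> n"
  shows "(INF x\<in>I. II a b D (F n) x) \<le> mu_sq a b D (\<FF> (Suc n)) / energy a b D (\<FF> (Suc n))"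
proof (rule ennreal_le_divideI)
  let ?c = "INF x\<in>I. II a b D (F n) x"
  have "?c * energy a b D (\<FF> (Suc n)) = (\<integral>\<^sup>+u. (?c * F n u) * F (Suc n) u \<partial>mu a b D)"
    unfolding energy_f_stop_Suc[OF n] by (subst nn_integral_cmult[symmetric]) (simp_all add: mult_ac)
  also have "\<dots> \<le> (\<integral>\<^sup>+u. F (Suc n) u * F (Suc n) u \<partial>mu a b D)"
    by (intro nn_integral_mono_AE eventually_mono[OF M_concentrated] mult_right_mono mult_f_stop_le n) simp_all
  also have "\<dots> = mu_sq a b D (\<FF> (Suc n))"
    by (simp add: mu_sq_f_stop)
  finally show "?c * energy a b D (\<FF> (Suc n)) \<le> mu_sq a b D (\<FF> (Suc n))" .
qed (simp_all add: energy_f_stop(2,3))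

text \<open>
  The infimum is attained at \<open>x\<^sub>0\<close>: to the right of \<open>x\<^sub>0\<close> only the numerator of \<open>II(f\<^sub>1)\<close> grows, and to
  the left \<open>II(f\<^sub>1)\<close> is an average of a tail, hence decreasing.
\<close>

lemma INF_II_f_stop_1_eq_ratio:
  "(INF x\<in>I. II a b D (F 1) x) = mu_sq a b D (\<FF> 1) / energy a b D (\<FF> 1)"
proof -
  let ?P = "prim (tail (F 1))" and ?\<phi> = "prim (\<lambda>_. 1)"
  have P: "?P x0 = mu_sq a b D (\<FF> 1)"
  proof -
    have "?P x0 = prim (\<lambda>s. 1 * tail (F 1) s) x0" by simp
    also have "\<dots> = (\<integral>\<^sup>+u. F 1 u * ?\<phi> (min u x0) \<partial>mu a b D)"
      by (rule prim_mult_tail) measurable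
    also have "\<dots> = mu_sq a b D (\<FF> 1)"
      by (subst mu_sq_f_stop) (simp_all add: f_stop_1[unfolded One_nat_def])
    finally show ?thesis .
  qed
  have E: "energy a b D (\<FF> 1) = ?\<phi> x0"
    by (simp add: energy_f_stop stop_density_def)
  have F_1: "F 1 x = ?\<phi> (min x x0)" for x by (rule f_stop_1)
  have II_x0: "II a b D (F 1) x0 = ?P x0 / ?\<phi> x0"
    by (simp only: II_eq F_1 min.idem)
  have phi: "0 < ?\<phi> x \<and> ?\<phi> x < top" if "x \<in> I" for x
    using that by (simp add: prim_1 Phi_pos D_gt_0)
  have "?P x0 / ?\<phi> x0 \<le> II a b D (F 1) x" if x: "x \<in> I" for x
  proof -
    let ?m = "min x x0"
    have m: "?m \<in> I" using x x0 by (rule min_in_I)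
    have "?\<phi> ?m * ?P x0 \<le> ?\<phi> x0 * ?P ?m"
      using D_gt_0[OF m] by (intro prim_tail_average_antimono) simp_all
    then have "?\<phi> ?m * ?P x0 / ?\<phi> x0 \<le> ?\<phi> x0 * ?P ?m / ?\<phi> x0"
      by (rule divide_right_mono_ennreal)
    also have "\<dots> = ?P ?m"
      using phi[OF x0] by (simp add: ennreal_times_divide[symmetric] ennreal_mult_divide_cancel)
    also have "\<dots> \<le> ?P x"
      by (rule prim_mono_right) simp
    finally have "?P x0 / ?\<phi> x0 * F 1 x \<le> ?P x"
      unfolding F_1 by (simp add: ennreal_times_divide mult.commute[of _ "?\<phi> ?m"])
    then show ?thesis
      using phi[OF m] by (subst le_II_iff) (simp_all add: f_stop_1[unfolded One_nat_def])
  qed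
  then show ?thesis
    unfolding P[symmetric] E II_x0[symmetric]
    by (intro antisym INF_greatest INF_lower x0)
qed

end

end

section \<open>Basic estimates of the first eigenvalue\<close>

theorem theorem6:
  fixes a b :: "real \<Rightarrow> real" and D :: ereal
  assumes D_pos: "0 < D"
    and a_meas: "a \<in> borel_measurable (restrict_space borel (cinterval D))"
    and b_meas: "b \<in> borel_measurable (restrict_space borel (cinterval D))"
    and a_pos: "\<And>x. x \<in> einterval 0 D \<Longrightarrow> 0 < a x"
    and ba_int: "locally_integrable_on (\<lambda>x. b x / a x) (cinterval D)"
    and eCa_int: "locally_integrable_on (\<lambda>x. exp (C_fun a b x) / a x) (cinterval D)"
    and mu_finite: "emeasure (mu a b D) (einterval 0 D) < \<infinity>"
    and delta_finite: "delta a b D < \<infinity>"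
  shows
    "(antimono_on {1..} (delta_seq a b D) \<and>
      (\<forall>n\<ge>1. lambda0 a b D \<ge> inverse (delta_seq a b D n) \<and>
              inverse (delta_seq a b D n) \<ge> inverse (4 * delta a b D))) \<and>
     (mono_on {1..} (delta'_seq a b D) \<and>
      (\<forall>n\<ge>1. inverse (delta a b D) \<ge> inverse (delta'_seq a b D n) \<and>
              inverse (delta'_seq a b D n) \<ge> lambda0 a b D)) \<and>
     (\<forall>n\<ge>1. inverse (delta_bar a b D n) \<ge> lambda0 a b D \<and>
              delta_bar a b D (n + 1) \<ge> delta'_seq a b D n) \<and>
     delta_bar a b D 1 = delta'_seq a b D 1"
proof -
  interpret diffusion a b D
    using D_pos a_meas a_pos ba_int mu_finite by unfold_locales
  have delta_top: "delta a b D < top" using delta_finite by simp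
  note bounds = f_seq_bounds[OF delta_top]

  have anti: "delta_seq a b D n \<le> delta_seq a b D m" if "1 \<le> m" "m \<le> n" for m n
    using that(2)
  proof (induction n rule: dec_induct)
    case (step n)
    then show ?case using bounds[of n] that(1) by (meson le_trans order_trans)
  qed simp
  have lower: "inverse (delta_seq a b D n) \<le> lambda0 a b D" if n: "1 \<le> n" for n
  proof (rule inverse_le_lambda0)
    show f: "0 < f_seq a b D n x \<and> f_seq a b D n x < top" if "x \<in> I" for x
      using bounds[OF n] that by blast
    show "prim (tail (f_seq a b D n)) x \<le> delta_seq a b D n * f_seq a b D n x" if "x \<in> I" for x
    proof -
      have "II a b D (f_seq a b D n) x \<le> delta_seq a b D n"
        unfolding delta_seq_def using that by (rule SUP_upper)
      then show ?thesis using f[OF that] by (simp add: II_le_iff)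
    qed
  qed measurable
  have part1: "inverse (4 * delta a b D) \<le> inverse (delta_seq a b D n)" if "1 \<le> n" for n
    using bounds[OF that] by (simp add: ennreal_inverse_antimono)

  have mono': "delta'_seq a b D m \<le> delta'_seq a b D n" if "1 \<le> m" "m \<le> n" for m n
    using that(2)
  proof (induction n rule: dec_induct)
    case (step n)
    have "delta'_seq a b D n \<le> delta'_seq a b D (Suc n)"
      unfolding delta'_seq_def
    proof (rule SUP_mono)
      fix x0 assume "x0 \<in> I"
      then show "\<exists>y\<in>I. (INF x\<in>I. II a b D (f_stop a b D x0 n) x) \<le> (INF x\<in>I. II a b D (f_stop a b D y (Suc n)) x)"
        using INF_II_f_stop_mono[of x0 n] step.hyps that(1) by (intro bexI[of _ x0]) auto
    qed
    with step.IH show ?case by (rule order_trans)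
  qed simp
  have "delta a b D \<le> delta'_seq a b D 1"
    unfolding delta_def delta'_seq_def
    using delta_le_INF_II_f_stop_1 by (intro SUP_mono) (auto simp: phi_def)
  then have delta_le: "delta a b D \<le> delta'_seq a b D n" if "1 \<le> n" for n
    using mono'[OF order_refl that] by (rule order_trans)

  have bar_le: "delta_bar a b D n \<le> inverse (lambda0 a b D)" if "1 \<le> n" for n
    unfolding delta_bar_def using f_stop_ratio_le that by (intro SUP_least)
  have bar_ge: "delta'_seq a b D n \<le> delta_bar a b D (Suc n)" if "1 \<le> n" for n
    unfolding delta'_seq_def delta_bar_def using INF_II_f_stop_le_ratio that
    by (intro SUP_mono) blast
  have bar_1: "delta_bar a b D 1 = delta'_seq a b D 1"
    unfolding delta'_seq_def delta_bar_def
    by (intro SUP_cong refl INF_II_f_stop_1_eq_ratio[symmetric])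
  have delta'_le: "delta'_seq a b D n \<le> inverse (lambda0 a b D)" if "1 \<le> n" for n
    using bar_ge[OF that] bar_le[of "Suc n"] by (auto intro: order_trans)
  have upper: "lambda0 a b D \<le> inverse y" if "y \<le> inverse (lambda0 a b D)" for y
    using ennreal_inverse_antimono[OF that] one_divide_one_divide_ennreal[of "lambda0 a b D"]
    by (simp add: divide_ennreal_def)
  show ?thesis
    using anti lower part1 mono' delta_le delta'_le bar_le bar_ge bar_1
    by (auto simp: monotone_on_def intro!: upper ennreal_inverse_antimono)
qed

end
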